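(* Let $G$ be a (finite) maximal triangle-free graph which contains the Mycielski–Grötzsch graph $\Upsilon$ as a subgraph and satisfies property $\mathscr{D}_4$. Then $G$ is a blow-up of some Vega graph $\Upsilon_i^{\mu\nu}$ ($i\ge2$, $\mu,\nu\in\{0,1\}$).
   Context: A graph is maximal triangle-free if it contains no triangle but adding any new edge creates a triangle. A blow-up of $H$ is any graph obtained by replacing each vertex of $H$ by a non-empty independent set and each edge of $H$ by the complete bipartite graph between the corresponding sets, with no further edges. Property $\mathscr{D}_k$: for every $m\in\{1,\dots,k\}$ and every sequence $x_1,\dots,x_{3m}$ of (not necessarily distinct) vertices there is a vertex $y$ with $|\{i\in[3m]: x_iy\in E(G)\}|\ge m+1$. Mycielski–Grötzsch graph $\Upsilon$: vertices $a_j,b_j$ ($j\in\mathbb Z/5\mathbb Z$) and $c$; edges all pairs $a_jc$, $a_jb_{j\pm2}$, $b_jb_{j+2}$. Andrásfai graph $\Gamma_i$: vertex set $\mathbb Z/(3i-1)\mathbb Z$, $jm$ an edge iff $j-m\in\{i,\dots,2i-1\}$ mod $3i-1$. Vega graphs: for $i\ge2$, $\Upsilon_i^{00}$ has vertex set $\mathbb Z/(3i-1)\mathbb Z\cup\{a,b,c,u,v,w,x,y\}$; edges: those of $\Gamma_i$; the hexagon $av,vc,cu,ub,bw,wa$; all edges from $a,u$ to $\{0,\dots,i-1\}$; from $b,v$ to $\{i,\dots,2i-1\}$; from $c,w$ to $\{2i,\dots,3i-2\}$; and $xa,xb,xc,yu,yv,yw,xy$. Further $\Upsilon_i^{10}=\Upsilon_i^{00}-y$,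 $\Upsilon_i^{01}=\Upsilon_i^{00}-(2i-1)$, $\Upsilon_i^{11}=\Upsilon_i^{00}-\{y,2i-1\}$. *)

theory Defs
  imports Main
begin

definition graph :: "'a set \<Rightarrow> ('a \<Rightarrow> 'a \<Rightarrow> bool) \<Rightarrow> bool" where
  "graph V E \<longleftrightarrow> (\<forall>x y. E x y \<longrightarrow> x \<in> V \<and> y \<in> V \<and> x \<noteq> y \<and> E y x)"

definition triangle_free :: "'a set \<Rightarrow> ('a \<Rightarrow> 'a \<Rightarrow> bool) \<Rightarrow> bool" where
  "triangle_free V E \<longleftrightarrow> \<not> (\<exists>x\<in>V. \<exists>y\<in>V. \<exists>z\<in>V. E x y \<and> E y z \<and> E x z)"

definition maximal_triangle_free :: "'a set \<Rightarrow> ('a \<Rightarrow> 'a \<Rightarrow> bool) \<Rightarrow> bool" where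
  "maximal_triangle_free V E \<longleftrightarrow> triangle_free V E \<and>
     (\<forall>x\<in>V. \<forall>y\<in>V. x \<noteq> y \<and> \<not> E x y \<longrightarrow> (\<exists>z\<in>V. E x z \<and> E z y))"

definition contains_subgraph ::
  "'b set \<Rightarrow> ('b \<Rightarrow> 'b \<Rightarrow> bool) \<Rightarrow> 'a set \<Rightarrow> ('a \<Rightarrow> 'a \<Rightarrow> bool) \<Rightarrow> bool" where
  "contains_subgraph VH EH V E \<longleftrightarrow>
     (\<exists>f. inj_on f VH \<and> f ` VH \<subseteq> V \<and> (\<forall>x\<in>VH. \<forall>y\<in>VH. EH x y \<longrightarrow> E (f x) (f y)))"

text \<open>G is a blow-up of H: there is a surjection phi from V onto VH (its fibres are the
non-empty sets replacing the vertices of H) such that two vertices of G are adjacent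
iff their images are adjacent in H.\<close>
definition blow_up ::
  "'a set \<Rightarrow> ('a \<Rightarrow> 'a \<Rightarrow> bool) \<Rightarrow> 'b set \<Rightarrow> ('b \<Rightarrow> 'b \<Rightarrow> bool) \<Rightarrow> bool" where
  "blow_up V E VH EH \<longleftrightarrow>
     (\<exists>\<phi>. \<phi> ` V = VH \<and> (\<forall>x\<in>V. \<forall>y\<in>V. E x y \<longleftrightarrow> EH (\<phi> x) (\<phi> y)))"

definition prop_D :: "nat \<Rightarrow> 'a set \<Rightarrow> ('a \<Rightarrow> 'a \<Rightarrow> bool) \<Rightarrow> bool" where
  "prop_D k V E \<longleftrightarrow>
     (\<forall>m\<in>{1..k}. \<forall>x :: nat \<Rightarrow> 'a. (\<forall>i<3*m. x i \<in> V) \<longrightarrow>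
        (\<exists>y\<in>V. card {i. i < 3*m \<and> E (x i) y} \<ge> m + 1))"

datatype mg_vertex = MA nat | MB nat | MC

definition mg_verts :: "mg_vertex set" where
  "mg_verts = {MA j | j. j < 5} \<union> {MB j | j. j < 5} \<union> {MC}"

fun mg_base :: "mg_vertex \<Rightarrow> mg_vertex \<Rightarrow> bool" where
  "mg_base (MA j) MC = (j < 5)"
| "mg_base (MA j) (MB k) = (j < 5 \<and> k < 5 \<and> (k = (j + 2) mod 5 \<or> k = (j + 3) mod 5))"
| "mg_base (MB j) (MB k) = (j < 5 \<and> k = (j + 2) mod 5)"
| "mg_base _ _ = False"

definition mg_adj :: "mg_vertex \<Rightarrow> mg_vertex \<Rightarrow> bool" where
  "mg_adj x y \<longleftrightarrow> mg_base x y \<or> mg_base y x"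

definition andrasfai_adj :: "nat \<Rightarrow> nat \<Rightarrow> nat \<Rightarrow> bool" where
  "andrasfai_adj i j m \<longleftrightarrow> j < 3*i - 1 \<and> m < 3*i - 1 \<and>
     (let d = (int j - int m) mod int (3*i - 1) in int i \<le> d \<and> d \<le> int (2*i - 1))"

datatype vega_vertex = Num nat | VA | VB | VC | VU | VV | VW | VX | VY

fun vega_base :: "nat \<Rightarrow> vega_vertex \<Rightarrow> vega_vertex \<Rightarrow> bool" where
  "vega_base i (Num j) (Num m) = andrasfai_adj i j m"
| "vega_base i VA VV = True"
| "vega_base i VV VC = True"
| "vega_base i VC VU = True"
| "vega_base i VU VB = True"
| "vega_base i VB VW = True"
| "vega_base i VW VA = True"
| "vega_base i VA (Num j) = (j < i)"
| "vega_base i VU (Num j) = (j < i)"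
| "vega_base i VB (Num j) = (i \<le> j \<and> j \<le> 2*i - 1)"
| "vega_base i VV (Num j) = (i \<le> j \<and> j \<le> 2*i - 1)"
| "vega_base i VC (Num j) = (2*i \<le> j \<and> j \<le> 3*i - 2)"
| "vega_base i VW (Num j) = (2*i \<le> j \<and> j \<le> 3*i - 2)"
| "vega_base i VX VA = True"
| "vega_base i VX VB = True"
| "vega_base i VX VC = True"
| "vega_base i VY VU = True"
| "vega_base i VY VV = True"
| "vega_base i VY VW = True"
| "vega_base i VX VY = True"
| "vega_base i _ _ = False"

definition vega_adj :: "nat \<Rightarrow> vega_vertex \<Rightarrow> vega_vertex \<Rightarrow> bool" where
  "vega_adj i x y \<longleftrightarrow> vega_base i x y \<or> vega_base i y x"

text \<open>Vertex set of Upsilon_i^{mu nu}: mu = True removes y, nu = True removes vertex 2i-1.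
The graph is the induced subgraph of Upsilon_i^{00} on this set.\<close>
definition vega_verts :: "nat \<Rightarrow> bool \<Rightarrow> bool \<Rightarrow> vega_vertex set" where
  "vega_verts i \<mu> \<nu> =
     ({Num j | j. j < 3*i - 1} \<union> {VA, VB, VC, VU, VV, VW, VX, VY})
     - (if \<mu> then {VY} else {}) - (if \<nu> then {Num (2*i - 1)} else {})"

end

theory Submission
  imports Defs
begin

text \<open>
  Fix a copy of \<Upsilon> in G and call the set of its vertices adjacent to a given vertex y the trace of y.
  Of the 20 independent sets of \<Upsilon> (up to its dihedral symmetry) only 7 can be traces: starting from a
  vertex with a forbidden trace, common neighbours of non-adjacent vertices and the vertices provided by
  D_2, D_3, D_4 are added until some vertex has a trace that is already excluded with respect to some
  copy of \<Upsilon>. If the copy of \<Upsilon> is rotated suitably, the remaining traces sort the vertices of G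
  into eleven classes: those of the hexagon vertices, of x and y, and the three classes A, B, C which are
  to become the Andrasfai part. Edges join compatible classes only, and by maximality compatible
  classes other than A, B, C are completely joined.

  Between A, B, C, property D_2 applied to closed walks of length six shows that the neighbourhoods in C
  of the vertices of A form a chain. The ranks in this chain determine all edges between A, B, C, and
  maximality leaves only an Andrasfai graph \<Gamma>_i, or \<Gamma>_i without the vertex 2i-1.
\<close>

section \<open>Certificates for the non-existence of partial embeddings\<close>

text \<open>
  Finitely many vertices are recorded by the list of the rows of the lower triangle of their adjacency
  matrix; in \<^term>\<open>mg_rows\<close>, the vertices 0,...,4 are a_j, the vertices 5,...,9 are b_j, and 10 is c.
  The extensions of a row are its prolongations which still describe an independent set.
\<close>

fun disjoint_rows :: "bool list \<Rightarrow> bool list \<Rightarrow> bool" where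
  "disjoint_rows (x # xs) (y # ys) \<longleftrightarrow> \<not> (x \<and> y) \<and> disjoint_rows xs ys"
| "disjoint_rows _ _ \<longleftrightarrow> True"

fun extensions :: "bool list list \<Rightarrow> bool list \<Rightarrow> bool list list" where
  "extensions [] r = [r]"
| "extensions (x # xs) r = extensions xs (r @ [False]) @
     (if disjoint_rows x r then extensions xs (r @ [True]) else [])"

fun weight :: "bool list \<Rightarrow> nat list \<Rightarrow> nat" where
  "weight (b # bs) (k # ks) = (if b then k + weight bs ks else weight bs ks)"
| "weight _ _ = 0"

definition mg_rows :: "bool list list" where
  "mg_rows = [[], [False], [False, False], [False, False, False], [False, False, False, False],
     [False, False, True, True, False],
     [False, False, False, True, True, False],
     [True, False, False, False, True, True, False],
     [True, True, False, False, False, True, True, False],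
     [False, True, True, False, False, False, True, True, False],
     [True, True, True, True, True, False, False, False, False, False]]"

definition adj_at :: "bool list list \<Rightarrow> nat \<Rightarrow> nat \<Rightarrow> bool" where
  "adj_at rows i j = (if j < i then rows ! i ! j else if i < j then rows ! j ! i else False)"

fun copy_at :: "bool list list \<Rightarrow> nat list \<Rightarrow> bool list list \<Rightarrow> nat list \<Rightarrow> bool" where
  "copy_at rows js [] [] \<longleftrightarrow> True"
| "copy_at rows js (r # rs) (i # is) \<longleftrightarrow> i < length rows \<and>
     list_all2 (\<lambda>b j. b \<longrightarrow> adj_at rows i j) r js \<and> copy_at rows (js @ [i]) rs is"
| "copy_at _ _ _ _ \<longleftrightarrow> False"

text \<open>
  A certificate refutes a recorded graph that contains \<Upsilon>, given a list A of admissible traces: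
  \<open>Copy is v\<close> by a second copy of \<Upsilon> at the positions \<open>is\<close> with respect to which v has an inadmissible
  trace; \<open>Nbr p q\<close> by a common neighbour of p and q; \<open>Many m ws\<close> by property D_m for the multiset with
  multiplicities \<open>ws\<close>. In the last two cases every possible row of the new vertex has a certificate.
\<close>

datatype cert = Copy "nat list" nat | Nbr nat nat "cert list" | Many nat "nat list" "cert list"

fun refutes :: "bool list list \<Rightarrow> bool list list \<Rightarrow> cert \<Rightarrow> bool"
  and refutes_all :: "bool list list \<Rightarrow> bool list list \<Rightarrow> bool list list \<Rightarrow> cert list \<Rightarrow> bool" where
  "refutes A xs (Copy is v) \<longleftrightarrow> (let rows = mg_rows @ xs in
     v < length rows \<and> copy_at rows [] mg_rows is \<and> map (adj_at rows v) is \<notin> set A)"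
| "refutes A xs (Nbr p q cs) \<longleftrightarrow> (let rows = mg_rows @ xs in
     p < q \<and> q < length rows \<and> \<not> rows ! q ! p \<and>
     refutes_all A xs (concat (map (\<lambda>t. filter (\<lambda>r. r ! p \<and> r ! q) (extensions xs t)) A)) cs)"
| "refutes A xs (Many m ws cs) \<longleftrightarrow>
     1 \<le> m \<and> m \<le> 4 \<and> length ws = length (mg_rows @ xs) \<and> sum_list ws = 3 * m \<and>
     refutes_all A xs (concat (map (\<lambda>t. filter (\<lambda>r. m < weight r ws) (extensions xs t)) A)) cs"
| "refutes_all A xs [] cs \<longleftrightarrow> True"
| "refutes_all A xs (r # rs) [] \<longleftrightarrow> False"
| "refutes_all A xs (r # rs) (c # cs) \<longleftrightarrow> refutes A (xs @ [r]) c \<and> refutes_all A xs rs cs"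

section \<open>Neighbours supplied by maximality and by property D\<close>

locale mtf_graph =
  fixes V :: "'a set" and E :: "'a \<Rightarrow> 'a \<Rightarrow> bool"
  assumes graph: "graph V E"
    and maximal: "maximal_triangle_free V E"
    and D4: "prop_D 4 V E"
begin

lemma E_sym: "E x y \<Longrightarrow> E y x"
  and E_irrefl: "\<not> E x x"
  and E_in: "E x y \<Longrightarrow> x \<in> V" "E x y \<Longrightarrow> y \<in> V"
  using graph unfolding graph_def by blast+

lemma E_commute: "E x y \<longleftrightarrow> E y x"
  by (rule iffI) (erule E_sym)+

lemma no_triangle: "E x y \<Longrightarrow> E y z \<Longrightarrow> \<not> E x z"
  using maximal E_in[of x y] E_in[of y z] unfolding maximal_triangle_free_def triangle_free_def by blast

lemma many_nbrs_list:
  assumes "m \<in> {1..4}" "length vs = 3 * m" "set vs \<subseteq> V"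
  obtains y where "y \<in> V" "m < length (filter (E y) vs)"
proof -
  have "\<forall>i<3 * m. vs ! i \<in> V" using assms by auto
  then obtain y where y: "y \<in> V" "m + 1 \<le> card {i. i < 3 * m \<and> E (vs ! i) y}"
    using D4 assms(1) unfolding prop_D_def by blast
  moreover have "{i. i < 3 * m \<and> E (vs ! i) y} = {i. i < length vs \<and> E y (vs ! i)}"
    using assms(2) by (simp add: E_commute[of y])
  ultimately show thesis by (intro that[of y]) (auto simp: length_filter_conv_card)
qed

text \<open>For p \<noteq> q this is maximality. The case p = q arises because a vertex may be
  recorded twice; there D_1 for p, p, p provides a neighbour.\<close>

lemma common_nbr:
  assumes "p \<in> V" "q \<in> V" "\<not> E p q"
  obtains z where "z \<in> V" "E z p" "E z q"
proof (cases "p = q")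
  case True
  obtain y where "y \<in> V" "1 < length (filter (E y) [p, p, p])"
    by (rule many_nbrs_list[of 1 "[p, p, p]"]) (use assms in auto)
  then show thesis using that[of y] True by (cases "E y p") auto
next
  case False
  then obtain z where "z \<in> V" "E p z" "E z q"
    using assms maximal unfolding maximal_triangle_free_def by blast
  then show thesis using that E_sym by blast
qed

text \<open>The map f below need not be injective: a vertex may be recorded more than once.\<close>

definition trace :: "(nat \<Rightarrow> 'a) \<Rightarrow> nat \<Rightarrow> 'a \<Rightarrow> bool list" where
  "trace f n y = map (\<lambda>j. E y (f j)) [0..<n]"

definition realizes :: "(nat \<Rightarrow> 'a) \<Rightarrow> bool list list \<Rightarrow> bool" where
  "realizes f rows \<longleftrightarrow> (\<forall>i<length rows. f i \<in> V \<and> rows ! i = trace f i (f i))"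

text \<open>Only edges are demanded; \<open>mg_copy_realizes\<close> recovers the non-edges.\<close>

definition mg_copy :: "(nat \<Rightarrow> 'a) \<Rightarrow> bool" where
  "mg_copy g \<longleftrightarrow> (\<forall>i<11. g i \<in> V) \<and> (\<forall>i<11. \<forall>j<i. mg_rows ! i ! j \<longrightarrow> E (g i) (g j))"

text \<open>Quantifying over all copies lets a trace excluded once be used against any copy found
  later, as \<open>Copy\<close> certificates do.\<close>

definition traces_in :: "bool list list \<Rightarrow> bool" where
  "traces_in A \<longleftrightarrow> (\<forall>g y. mg_copy g \<and> y \<in> V \<longrightarrow> trace g 11 y \<in> set A)"

lemma length_trace [simp]: "length (trace f n y) = n"
  and nth_trace [simp]: "j < n \<Longrightarrow> trace f n y ! j = E y (f j)"
  and trace_Suc: "trace f (Suc n) y = trace f n y @ [E y (f n)]"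
  by (auto simp: trace_def)

lemma trace_upd: "trace (f(n := y)) n z = trace f n z"
  by (auto simp: trace_def)

lemma trace_cong: "(\<And>j. j < n \<Longrightarrow> f j = g j) \<Longrightarrow> trace f n y = trace g n y"
  by (auto simp: trace_def)

lemma realizes_snoc:
  assumes "realizes f rows" "y \<in> V"
  shows "realizes (f(length rows := y)) (rows @ [trace f (length rows) y])"
  unfolding realizes_def
proof (intro allI impI)
  fix i assume "i < length (rows @ [trace f (length rows) y])"
  then consider "i < length rows" | "i = length rows" by fastforce
  then show "(f(length rows := y)) i \<in> V \<and>
    (rows @ [trace f (length rows) y]) ! i = trace (f(length rows := y)) i ((f(length rows := y)) i)"
    using assms by cases (auto simp: realizes_def nth_append trace_upd intro!: trace_cong)
qed

lemma disjoint_rows_iff: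
  "disjoint_rows xs ys \<longleftrightarrow> (\<forall>i. i < length xs \<and> i < length ys \<longrightarrow> \<not> (xs ! i \<and> ys ! i))"
proof (induction xs ys rule: disjoint_rows.induct)
  case (1 x xs y ys)
  show ?case
    unfolding disjoint_rows.simps 1 by (force simp: nth_Cons less_Suc_eq_0_disj split: nat.splits)
qed auto

lemma extensions_Cons:
  "b \<longrightarrow> disjoint_rows x r \<Longrightarrow> set (extensions xs (r @ [b])) \<subseteq> set (extensions (x # xs) r)"
  by (cases b) (simp_all only: extensions.simps set_append Un_upper1 Un_upper2 if_True simp_thms)

text \<open>The entries after the first n are added one at a time: if y sees \<open>f n\<close>,
  triangle-freeness makes the row of \<open>f n\<close> disjoint from the trace so far, so
  \<open>extensions\<close> keeps this branch.\<close>

lemma trace_in_extensions: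
  assumes "realizes f rows" "n \<le> length rows"
  shows "trace f (length rows) y \<in> set (extensions (drop n rows) (trace f n y))"
  using assms(2)
proof (induction "length rows - n" arbitrary: n)
  case 0
  then have "n = length rows" by simp
  then show ?case by simp
next
  case (Suc k)
  then have n: "n < length rows" by simp
  have "disjoint_rows (rows ! n) (trace f n y)" if "E y (f n)"
    using assms(1) n no_triangle[OF that] by (simp add: disjoint_rows_iff realizes_def)
  then have "set (extensions (drop (Suc n) rows) (trace f (Suc n) y))
      \<subseteq> set (extensions (rows ! n # drop (Suc n) rows) (trace f n y))"
    unfolding trace_Suc by (intro extensions_Cons) blast
  moreover have "trace f (length rows) y \<in> set (extensions (drop (Suc n) rows) (trace f (Suc n) y))"
    using Suc.hyps(2) n by (intro Suc.hyps(1)) linarith+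
  ultimately show ?case
    unfolding Cons_nth_drop_Suc[OF n] by (rule subsetD)
qed

text \<open>A multiset given by multiplicities is unfolded into a list, to which property D
  applies.\<close>

lemma trace_weight:
  "length ws = length vs \<Longrightarrow>
   weight (map (E y) vs) ws = length (filter (E y) (concat (map2 replicate ws vs)))"
  by (induction ws vs rule: list_induct2) auto

lemma length_concat_replicate:
  "length ws = length vs \<Longrightarrow> length (concat (map2 replicate ws vs)) = sum_list ws"
  by (induction ws vs rule: list_induct2) auto

lemma set_concat_replicate:
  "length ws = length vs \<Longrightarrow> set (concat (map2 replicate ws vs)) \<subseteq> set vs"
  by (induction ws vs rule: list_induct2) auto

lemma adj_at_realizes:
  assumes "realizes f rows" "i < length rows" "j < length rows"
  shows "adj_at rows i j \<longleftrightarrow> E (f i) (f j)"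
proof -
  have row: "rows ! k ! l = E (f k) (f l)" if "l < k" "k < length rows" for k l
    using assms(1) that by (simp add: realizes_def)
  consider "i < j" | "j < i" | "i = j" by linarith
  then show ?thesis
    by cases (use row[of j i] row[of i j] assms E_sym[of "f i" "f j"] E_sym[of "f j" "f i"] E_irrefl in
      \<open>auto simp: adj_at_def\<close>)
qed

text \<open>In the recursion the position just checked moves from \<open>is\<close> to
  \<open>js\<close>, which leaves \<open>js @ is\<close> unchanged.\<close>

lemma copy_at_edges:
  assumes "copy_at rows js rs is"
  shows "length is = length rs \<and> (\<forall>i<length rs. is ! i < length rows \<and>
    (\<forall>j<length (rs ! i). rs ! i ! j \<longrightarrow> adj_at rows (is ! i) ((js @ is) ! j)))"
  using assms
proof (induction rows js rs "is" rule: copy_at.induct)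
  case (2 rows js r rs k ks)
  have k: "k < length rows" "list_all2 (\<lambda>b j. b \<longrightarrow> adj_at rows k j) r js"
    and ks: "copy_at rows (js @ [k]) rs ks"
    using 2(2) by auto
  have IH: "length ks = length rs" "\<And>i. i < length rs \<Longrightarrow> ks ! i < length rows"
    "\<And>i j. i < length rs \<Longrightarrow> j < length (rs ! i) \<Longrightarrow> rs ! i ! j \<Longrightarrow>
      adj_at rows (ks ! i) ((js @ k # ks) ! j)"
    using 2(1)[OF ks] unfolding append.assoc append_Cons append_Nil by blast+
  have r: "adj_at rows k ((js @ k # ks) ! j)" if "j < length r" "r ! j" for j
    using list_all2_lengthD[OF k(2)] list_all2_nthD[OF k(2)] that by (simp add: nth_append)
  show ?case
  proof (intro conjI allI impI)
    show "length (k # ks) = length (r # rs)" using IH(1) by simp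
  next
    fix i assume i: "i < length (r # rs)"
    show "(k # ks) ! i < length rows" using i IH(2) k(1) by (cases i) simp_all
    fix j assume "j < length ((r # rs) ! i)" "(r # rs) ! i ! j"
    then show "adj_at rows ((k # ks) ! i) ((js @ k # ks) ! j)"
      using i IH(3) r by (cases i) simp_all
  qed
qed simp_all

lemma many_nbrs_weighted:
  assumes "realizes f rows" "m \<in> {1..4}" "length ws = length rows" "sum_list ws = 3 * m"
  obtains y where "y \<in> V" "m < weight (trace f (length rows) y) ws"
proof -
  define vs where "vs = map f [0..<length rows]"
  have len: "length ws = length vs" using assms(3) by (simp add: vs_def)
  have "set vs \<subseteq> V" using assms(1) by (auto simp: vs_def realizes_def)
  then have "set (concat (map2 replicate ws vs)) \<subseteq> V"
    using set_concat_replicate[OF len] by (rule subset_trans[rotated])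
  then obtain y where "y \<in> V" "m < length (filter (E y) (concat (map2 replicate ws vs)))"
    using many_nbrs_list[OF assms(2)] length_concat_replicate[OF len] assms(4) by metis
  moreover have "trace f (length rows) y = map (E y) vs"
    by (simp add: trace_def vs_def)
  ultimately show thesis
    using that trace_weight[OF len] by simp
qed

section \<open>Copies of \<Upsilon> are induced\<close>

lemma length_mg_rows [simp]: "length mg_rows = 11"
  by (simp add: mg_rows_def)

lemma length_mg_rows_nth: "i < 11 \<Longrightarrow> length (mg_rows ! i) = i"
proof -
  have "list_all (\<lambda>i. length (mg_rows ! i) = i) [0..<11]" by code_simp
  then show "i < 11 \<Longrightarrow> length (mg_rows ! i) = i" by (simp add: list_all_iff)
qed

lemma mg_rows_diameter:
  assumes "i < 11" "j < i" "\<not> mg_rows ! i ! j"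
  obtains k where "k < 11" "adj_at mg_rows k i" "adj_at mg_rows k j"
proof -
  have "list_all (\<lambda>i. list_all (\<lambda>j. mg_rows ! i ! j \<or>
    list_ex (\<lambda>k. adj_at mg_rows k i \<and> adj_at mg_rows k j) [0..<11]) [0..<i]) [0..<11]"
    by code_simp
  then have "list_ex (\<lambda>k. adj_at mg_rows k i \<and> adj_at mg_rows k j) [0..<11]"
    using assms by (simp only: list_all_iff set_upt atLeastLessThan_iff Ball_def zero_le simp_thms) blast
  then show thesis using that unfolding list_ex_iff by auto
qed

lemma mg_copy_adj:
  assumes "mg_copy g" "i < 11" "j < 11" "adj_at mg_rows i j"
  shows "E (g i) (g j)"
proof -
  consider "i < j" | "j < i" using assms(4) by (auto simp: adj_at_def split: if_splits)
  then show ?thesis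
    using assms by cases (auto simp: adj_at_def mg_copy_def E_commute[of "g i"])
qed

text \<open>Non-adjacent vertices of \<Upsilon> have a common neighbour in \<Upsilon>, so an
  additional edge of G between their images would close a triangle.\<close>

lemma mg_copy_realizes:
  assumes "mg_copy g"
  shows "realizes g mg_rows"
  unfolding realizes_def
proof (intro allI impI conjI)
  fix i assume "i < length mg_rows"
  then have i: "i < 11" by simp
  then show "g i \<in> V" using assms by (simp add: mg_copy_def)
  show "mg_rows ! i = trace g i (g i)"
  proof (rule nth_equalityI)
    show "length (mg_rows ! i) = length (trace g i (g i))"
      using i by (simp add: length_mg_rows_nth)
    fix j assume "j < length (mg_rows ! i)"
    then have j: "j < i" using i by (simp add: length_mg_rows_nth)
    show "mg_rows ! i ! j = trace g i (g i) ! j"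
    proof (cases "mg_rows ! i ! j")
      case True
      then show ?thesis using assms i j by (simp add: mg_copy_def)
    next
      case False
      then obtain k where "k < 11" "adj_at mg_rows k i" "adj_at mg_rows k j"
        using mg_rows_diameter i j by blast
      then have "E (g k) (g i)" "E (g k) (g j)"
        using mg_copy_adj[OF assms] i j by auto
      then show ?thesis
        using False j no_triangle[of "g i" "g k" "g j"] by (simp add: E_commute[of _ "g k"])
    qed
  qed
qed

section \<open>Soundness of certificates\<close>

lemma realizes_copy:
  assumes "realizes f rows" "copy_at rows [] mg_rows is"
  shows "mg_copy (\<lambda>i. f (is ! i))"
proof -
  have e: "is ! i < length rows" "j < i \<Longrightarrow> mg_rows ! i ! j \<Longrightarrow> adj_at rows (is ! i) (is ! j)"
    if "i < 11" for i j
    using copy_at_edges[OF assms(2)] that length_mg_rows_nth[OF that] by auto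
  have "E (f (is ! i)) (f (is ! j))" if "i < 11" "j < i" "mg_rows ! i ! j" for i j
    using adj_at_realizes[OF assms(1), of "is ! i" "is ! j"] e(1)[of i] e(1)[of j]
      e(2)[of i j] that by simp
  then show ?thesis
    using assms(1) e(1) by (auto simp: mg_copy_def realizes_def)
qed

lemma realizes_mg_copy:
  assumes "realizes f (mg_rows @ xs)"
  shows "mg_copy f"
proof -
  have row: "mg_rows ! i = trace f i (f i) \<and> f i \<in> V" if "i < 11" for i
    using assms that unfolding realizes_def by (auto simp: nth_append dest: spec[of _ i])
  then show ?thesis by (simp add: mg_copy_def)
qed

text \<open>The candidates in \<open>refutes\<close> are the admissible traces on \<Upsilon>,
  prolonged along the other recorded vertices and filtered by the property P for which the new
  vertex was chosen.\<close>

lemma trace_in_candidates: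
  assumes "traces_in A" "realizes f (mg_rows @ xs)" "y \<in> V" "P (trace f (length (mg_rows @ xs)) y)"
  shows "trace f (length (mg_rows @ xs)) y \<in> set (concat (map (\<lambda>t. filter P (extensions xs t)) A))"
proof -
  have "trace f 11 y \<in> set A"
    using assms(1,3) realizes_mg_copy[OF assms(2)] by (simp add: traces_in_def)
  moreover have "trace f (length (mg_rows @ xs)) y \<in> set (extensions xs (trace f 11 y))"
    using trace_in_extensions[OF assms(2), of 11 y] by simp
  ultimately show ?thesis using assms(4) by auto
qed

text \<open>Simultaneous induction. A \<open>Copy\<close> certificate contradicts the admissibility
  of traces; in the other two cases the vertex called for exists in G, while each of its candidate
  rows is refuted.\<close>

lemma refutes_sound:
  assumes "traces_in A"
  shows "realizes f (mg_rows @ xs) \<Longrightarrow> \<not> refutes A xs c"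
    and "realizes f (mg_rows @ xs) \<Longrightarrow> refutes_all A xs rs cs \<Longrightarrow> y \<in> V \<Longrightarrow>
      trace f (length (mg_rows @ xs)) y \<notin> set rs"
  using assms
proof (induction A xs c and A xs rs cs arbitrary: f and f y rule: refutes_refutes_all.induct)
  case (1 A xs "is" v)
  show ?case
  proof
    assume "refutes A xs (Copy is v)"
    then have v: "v < length (mg_rows @ xs)" and c: "copy_at (mg_rows @ xs) [] mg_rows is"
      and t: "map (adj_at (mg_rows @ xs) v) is \<notin> set A"
      by (auto simp: Let_def)
    have "length is = 11" and lt: "\<And>i. i < 11 \<Longrightarrow> is ! i < length (mg_rows @ xs)"
      using copy_at_edges[OF c] by auto
    then have "map (adj_at (mg_rows @ xs) v) is = trace (\<lambda>i. f (is ! i)) 11 (f v)"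
      using adj_at_realizes[OF 1(1) v lt] by (intro nth_equalityI) auto
    moreover have "f v \<in> V" using 1(1) v by (simp add: realizes_def)
    ultimately show False
      using t 1(2) realizes_copy[OF 1(1) c] by (simp add: traces_in_def)
  qed
next
  case (2 A xs p q cs)
  show ?case
  proof
    assume r: "refutes A xs (Nbr p q cs)"
    define P where "P = (\<lambda>r :: bool list. r ! p \<and> r ! q)"
    have pq: "p < q" "q < length (mg_rows @ xs)" "\<not> (mg_rows @ xs) ! q ! p"
      and all: "refutes_all A xs (concat (map (\<lambda>t. filter P (extensions xs t)) A)) cs"
      using r by (auto simp: Let_def P_def)
    have "f p \<in> V" "f q \<in> V" "\<not> E (f q) (f p)"
      using 2(2) pq by (auto simp: realizes_def)
    then obtain z where z: "z \<in> V" "E z (f q)" "E z (f p)"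
      using common_nbr by blast
    have "P (trace f (length (mg_rows @ xs)) z)"
      using z pq by (simp add: P_def del: length_append)
    then show False
      using 2(1)[OF refl 2(2) all[unfolded P_def] z(1) 2(3)]
        trace_in_candidates[OF 2(3,2) z(1), of P] unfolding P_def by blast
  qed
next
  case (3 A xs m ws cs)
  show ?case
  proof
    assume r: "refutes A xs (Many m ws cs)"
    define P where "P = (\<lambda>r. m < weight r ws)"
    have m: "m \<in> {1..4}" "length ws = length (mg_rows @ xs)" "sum_list ws = 3 * m"
      and all: "refutes_all A xs (concat (map (\<lambda>t. filter P (extensions xs t)) A)) cs"
      using r by (auto simp: P_def)
    obtain z where z: "z \<in> V" "P (trace f (length (mg_rows @ xs)) z)"
      using many_nbrs_weighted[OF 3(2) m] unfolding P_def by blast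
    then show False
      using 3(1)[OF 3(2) all[unfolded P_def] z(1) 3(3)]
        trace_in_candidates[OF 3(3,2) z(1), of P] unfolding P_def by blast
  qed
next
  case (6 A xs r rs c cs)
  \<comment> \<open>Recording y as the next vertex would realize the graph extended by r, which c
    refutes.\<close>
  have "\<not> trace f (length (mg_rows @ xs)) y = r"
  proof
    assume "trace f (length (mg_rows @ xs)) y = r"
    then have "realizes (f(length (mg_rows @ xs) := y)) (mg_rows @ (xs @ [r]))"
      using realizes_snoc[OF 6(3,5)] by simp
    then show False using 6(1)[OF _ 6(6)] 6(4) by simp
  qed
  then show ?case using 6(2)[OF 6(3) _ 6(5,6)] 6(4) by simp
qed simp_all

end
section \<open>Traces on a copy of the Mycielski--Groetzsch graph\<close>

definition mg_row :: "nat list \<Rightarrow> bool list" where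
  "mg_row is = map (\<lambda>j. j \<in> set is) [0..<11]"

text \<open>The automorphism of \<Upsilon> that negates indices mod 5; it fixes a_0, b_0 and
  c.\<close>

definition reflection :: "nat list" where
  "reflection = [0, 4, 3, 2, 1, 5, 9, 8, 7, 6, 10]"

definition dihedral :: "nat list list" where
  "dihedral = concat (map (\<lambda>is. [is @ map (\<lambda>j. j + 5) is @ [10],
     rev is @ map (\<lambda>j. j + 5) (rev is) @ [10]])
     [[0, 1, 2, 3, 4], [1, 2, 3, 4, 0], [2, 3, 4, 0, 1], [3, 4, 0, 1, 2], [4, 0, 1, 2, 3]])"

definition remove_class :: "bool list list \<Rightarrow> bool list \<Rightarrow> bool list list" where
  "remove_class A S = filter (\<lambda>t. list_all (\<lambda>is. map ((!) t) is \<noteq> S) dihedral) A"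

text \<open>Each pair consists of a trace S and of a certificate against the extension of \<Upsilon> by a vertex with trace S.\<close>

fun sieve :: "bool list list \<Rightarrow> (bool list \<times> cert) list \<Rightarrow> bool list list" where
  "sieve A [] = A"
| "sieve A ((S, c) # ps) = (if refutes A [S] c then sieve (remove_class A S) ps else A)"

text \<open>Found by computer search; the order matters, since certificates use that the earlier traces are excluded.\<close>

definition trace_certs :: "(bool list \<times> cert) list" where
  "trace_certs =
   [(mg_row [0, 1, 2, 3],
     Nbr 4 11 [Many 4 [1,1,0,1,1,1,1,1,1,1,1,1,1] [Many 4 [1,0,1,1,1,1,1,1,0,1,1,1,1,1] []],
     Many 4 [1,1,0,1,1,1,1,1,1,1,1,1,1] [Many 4 [1,0,1,1,1,1,1,1,0,1,1,1,1,1] []], Many 4 [1,0,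
     1,1,1,1,1,1,1,1,1,1,1] [], Many 4 [1,0,1,1,1,1,1,1,1,1,1,1,1] [], Many 4 [1,1,0,1,1,1,1,1,
     1,1,1,1,1] [], Many 4 [1,1,0,1,1,1,1,1,1,1,1,1,1] []]),
    (mg_row [0, 1, 2],
     Many 4 [1,0,1,1,1,1,2,1,1,1,1,1] [Copy [0,1,2,3,12,5,6,7,8,9,10] 11, Copy [0,1,2,12,4,5,6,
     7,8,9,10] 11, Copy [4,3,8,11,9,0,2,7,10,5,12] 6]),
    (mg_row [0, 2, 6],
     Nbr 1 11 [Many 4 [1,1,1,1,0,1,1,1,1,1,1,1,1] [Many 4 [1,1,1,0,1,0,1,1,1,1,1,1,1,1] []],
     Many 4 [1,1,1,1,0,1,1,1,1,1,1,1,1] [], Many 4 [1,1,1,0,1,1,1,1,1,1,1,1,1] [], Many 4 [1,1,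
     1,0,1,1,1,1,1,1,1,1,1] [], Many 4 [1,1,1,0,1,1,1,1,1,1,1,1,1] [], Many 4 [1,1,1,1,0,1,1,1,
     1,1,1,1,1] [], Many 4 [1,1,1,1,0,1,1,1,1,1,1,1,1] [], Many 4 [1,1,1,1,0,1,1,1,1,1,1,1,1]
     []]),
    (mg_row [0, 1, 3],
     Nbr 2 11 [Many 4 [1,1,1,1,0,1,1,1,1,1,1,1,1] [Many 4 [0,1,1,1,1,1,1,1,0,1,1,1,1,1] []],
     Many 4 [0,1,1,1,1,1,1,1,1,1,1,1,1] [], Many 4 [0,1,1,1,1,1,1,1,1,1,1,1,1] [Many 4 [1,1,1,1,
     0,1,0,1,1,1,1,1,1,1] []], Many 4 [0,1,1,1,1,1,1,1,1,1,1,1,1] [], Many 4 [1,1,1,1,0,1,1,1,1,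
     1,1,1,1] [], Many 4 [1,1,1,1,0,1,1,1,1,1,1,1,1] [], Many 4 [1,0,1,1,1,1,1,1,1,1,1,1,1] []]),
    (mg_row [0, 2],
     Many 4 [1,0,1,1,1,1,2,1,1,1,1,1] [Copy [0,1,2,3,12,5,6,7,8,9,10] 11, Copy [0,1,2,12,4,5,6,
     7,8,9,10] 11, Copy [4,3,8,11,9,0,2,7,10,5,12] 1]),
    (mg_row [0, 6],
     Nbr 1 11 [Many 3 [0,1,0,1,1,1,1,1,0,0,1,1,1] [Copy [0,1,2,3,13,5,6,7,8,9,10] 12, Copy [0,1,
     2,13,4,5,6,7,8,9,10] 12, Copy [4,3,11,8,9,0,1,7,10,13,6] 5], Many 3 [0,1,0,1,1,1,1,1,0,0,1,
     1,1] [Copy [4,13,11,8,9,0,1,7,10,12,6] 5, Copy [4,3,11,8,9,0,1,7,10,13,6] 5], Many 4 [1,1,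
     1,0,1,1,1,1,1,1,1,1,1] [], Many 3 [0,1,1,0,1,1,1,0,1,0,1,1,1] [Copy [0,1,2,13,4,5,6,7,8,9,
     10] 12, Copy [1,0,5,13,6,2,4,9,10,7,8] 11], Many 3 [1,1,0,1,0,0,1,1,0,1,1,1,1] [Copy [4,3,
     11,8,9,0,1,7,10,13,6] 5, Copy [1,2,7,13,6,0,3,8,10,5,9] 12], Copy [4,3,11,8,9,0,1,7,10,12,
     6] 5]),
    (mg_row [5],
     Nbr 0 11 [Many 3 [1,0,1,1,0,1,1,0,0,1,1,1,1] [Copy [0,1,13,3,4,5,6,7,8,9,10] 12, Copy [0,1,
     2,13,4,5,6,7,8,9,10] 12, Copy [1,2,7,13,6,0,3,8,10,5,9] 11, Copy [4,3,8,13,9,0,2,7,10,5,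
     6] 11, Many 3 [0,1,0,0,1,1,1,1,1,1,0,1,0,1] [Copy [0,1,2,11,4,5,14,7,8,9,13] 10, Copy [0,1,
     2,11,4,5,14,7,8,9,13] 10, Copy [0,1,11,3,4,5,6,7,8,14,13] 10, Copy [0,1,11,3,4,5,6,7,8,14,
     13] 10]], Many 3 [1,0,1,0,0,1,1,0,1,1,1,1,1] [Copy [0,13,2,3,4,5,6,7,8,9,10] 12, Copy [0,
     13,2,3,4,5,6,7,8,9,10] 11, Copy [0,1,13,3,4,5,6,7,8,9,10] 12, Copy [0,1,2,13,4,5,6,7,8,9,
     10] 12, Copy [4,3,8,13,9,0,2,7,10,5,6] 11], Many 3 [1,0,1,0,0,1,1,0,1,1,1,1,1] [Copy [0,13,
     2,3,4,5,6,7,8,9,10] 11, Copy [1,2,7,12,6,0,13,8,10,5,9] 11, Copy [4,3,8,13,9,0,2,7,10,5,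
     6] 11], Copy [1,2,7,12,6,0,3,8,10,5,9] 11, Many 3 [1,0,0,1,0,1,1,1,0,1,1,1,1] [Copy [0,1,2,
     3,13,5,6,7,8,9,10] 12, Copy [0,1,2,3,13,5,6,7,8,9,10] 11, Copy [0,1,13,3,4,5,6,7,8,9,
     10] 12, Copy [0,1,2,13,4,5,6,7,8,9,10] 12, Copy [1,2,7,13,6,0,3,8,10,5,9] 11], Many 3 [1,0,
     0,1,0,1,1,1,0,1,1,1,1] [Copy [0,1,2,3,13,5,6,7,8,9,10] 11, Copy [4,3,8,12,9,0,13,7,10,5,
     6] 11, Copy [1,2,7,13,6,0,3,8,10,5,9] 11], Copy [4,3,8,12,9,0,2,7,10,5,6] 11, Many 3 [0,1,
     0,0,1,1,1,1,1,1,0,1,1] [Copy [0,1,2,11,4,5,13,7,8,9,12] 10, Copy [0,1,2,11,4,5,13,7,8,9,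
     12] 10, Copy [0,1,11,3,4,5,6,7,8,13,12] 10, Copy [0,1,11,3,4,5,6,7,8,13,12] 10]]),
    (mg_row [0],
     Many 4 [0,1,1,1,1,2,1,1,1,1,1,1] [Copy [0,1,12,3,4,5,6,7,8,9,10] 11, Copy [0,1,2,12,4,5,6,
     7,8,9,10] 11, Many 4 [1,1,0,1,1,1,1,1,1,1,1,1,1] [Copy [0,1,2,3,4,5,13,7,8,9,10] 11], Copy
     [0,1,2,3,4,5,12,7,8,9,10] 11, Nbr 5 11 [Many 4 [0,1,0,1,1,1,1,1,1,1,1,1,1,1] [Copy [0,1,2,
     13,4,5,14,7,8,9,10] 11, Copy [0,1,2,3,4,5,14,7,8,9,10] 11], Copy [1,2,3,4,0,6,7,8,9,12,
     10] 13, Copy [0,1,13,3,4,5,6,7,8,9,10] 11, Copy [1,2,3,4,0,6,7,8,9,12,10] 13, Copy [0,1,2,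
     13,4,5,6,7,8,9,10] 11, Many 4 [0,1,0,1,1,1,1,1,1,1,1,1,1,1] [Copy [0,1,2,3,4,5,14,7,8,9,
     10] 11], Many 4 [0,1,1,0,1,1,1,1,1,1,1,1,1,1] [Copy [0,1,2,3,4,5,6,7,8,14,10] 11]], Copy
     [1,0,5,12,6,2,4,9,10,7,8] 11, Many 4 [1,1,1,0,1,1,1,1,1,1,1,1,1] [Copy [0,1,2,3,4,5,6,7,8,
     13,10] 11], Copy [0,1,2,3,4,5,6,7,8,12,10] 11, Copy [0,4,9,12,5,1,3,8,10,6,7] 11]),
    (mg_row [],
     Many 4 [1,1,1,1,0,1,1,1,1,1,2,1] [Copy [0,12,2,3,4,5,6,7,8,9,10] 11, Copy [12,1,2,3,4,5,6,
     7,8,9,10] 11, Copy [0,1,2,3,12,5,6,7,8,9,10] 11, Copy [0,1,12,3,4,5,6,7,8,9,10] 11, Copy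
     [0,1,2,12,4,5,6,7,8,9,10] 11, Copy [1,2,3,4,0,6,7,8,9,12,10] 11, Copy [0,1,2,3,4,5,6,7,8,
     12,10] 11, Copy [0,4,9,12,5,1,3,8,10,6,7] 11, Copy [0,1,2,3,4,5,6,7,12,9,10] 11, Copy [4,3,
     8,12,9,0,2,7,10,5,6] 11, Nbr 10 11 [Many 4 [0,1,0,1,1,1,1,1,1,1,1,1,1,1] [Copy [0,1,2,3,4,
     5,14,7,8,9,12] 13, Copy [0,1,2,3,4,5,14,7,8,9,10] 11], Copy [0,1,2,3,4,5,6,7,8,9,12] 13,
     Copy [0,1,2,3,4,5,6,7,8,9,12] 13, Copy [0,13,2,3,4,5,6,7,8,9,10] 11, Copy [0,1,2,3,4,5,6,7,
     8,9,12] 13, Copy [13,1,2,3,4,5,6,7,8,9,10] 11, Copy [0,1,2,3,4,5,6,7,8,9,12] 13, Copy [0,1,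
     2,3,13,5,6,7,8,9,10] 11, Copy [0,1,2,3,4,5,6,7,8,9,12] 13, Copy [0,1,13,3,4,5,6,7,8,9,
     10] 11, Copy [0,1,2,13,4,5,6,7,8,9,10] 11]]),
    (mg_row [0, 1],
     Many 4 [0,1,1,1,1,2,1,1,1,1,1,1] [Copy [0,1,12,3,4,5,6,7,8,9,10] 11, Copy [0,1,2,12,4,5,6,
     7,8,9,10] 11, Many 3 [1,1,0,1,0,1,0,1,0,1,1,1,1] [Copy [0,1,13,3,4,5,6,7,8,9,10] 11, Copy
     [0,4,9,13,5,1,3,8,10,6,7] 12], Nbr 6 11 [Many 4 [1,0,1,0,1,1,1,1,1,1,1,1,1,1] [Copy [0,13,
     3,2,1,5,9,8,14,6,10] 11], Copy [0,1,2,3,4,5,12,7,8,9,10] 13, Copy [0,1,2,3,13,5,6,7,8,9,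
     10] 11, Copy [0,1,2,3,4,5,12,7,8,9,10] 13, Copy [0,1,2,13,4,5,6,7,8,9,10] 11, Many 3 [1,1,
     0,1,0,0,1,1,0,1,1,1,0,1] [Copy [0,1,2,3,14,5,6,7,8,9,10] 11, Copy [1,2,7,14,6,0,3,8,10,5,
     9] 13]], Nbr 5 11 [Many 4 [0,1,1,0,1,1,1,1,1,1,1,1,1,1] [Copy [0,1,13,3,4,5,6,7,8,14,
     10] 11], Copy [1,2,3,4,0,6,7,8,9,12,10] 13, Copy [0,1,13,3,4,5,6,7,8,9,10] 11, Copy [1,2,3,
     4,0,6,7,8,9,12,10] 13, Copy [0,1,2,13,4,5,6,7,8,9,10] 11, Many 3 [0,1,1,0,1,1,0,0,1,0,1,1,
     1,1] [Copy [1,0,5,14,6,2,4,9,10,7,8] 11, Copy [2,3,8,14,7,1,4,9,10,6,5] 11]], Copy [1,0,5,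
     12,6,2,4,9,10,7,8] 11]),
    (mg_row [5, 6],
     Nbr 0 11 [Nbr 1 11 [Many 4 [1,1,0,1,0,1,1,1,1,1,1,1,1,1] [Copy [5,6,12,10,13,0,1,7,8,9,
     14] 3], Copy [0,4,9,13,5,1,3,8,10,6,7] 12, Copy [0,1,2,11,4,5,6,7,8,9,13] 10], Nbr 1 11
     [Copy [1,2,7,12,6,0,3,8,10,5,9] 13, Copy [5,6,12,10,13,0,1,7,8,9,3] 11, Copy [0,1,2,11,4,5,
     6,7,8,9,13] 10], Copy [0,1,2,11,4,5,6,7,8,9,12] 10]),
    (mg_row [0, 5],
     Nbr 1 11 [Many 4 [1,1,1,0,1,1,1,1,1,1,1,1,1] [Nbr 4 11 [Copy [0,1,2,3,4,5,6,7,8,13,10] 14,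
     Copy [0,1,2,3,4,5,6,7,8,13,10] 14, Copy [0,1,2,3,4,5,6,7,8,13,10] 14, Many 3 [1,0,1,0,1,0,
     1,0,1,0,1,1,0,1,1] [Copy [1,2,11,7,6,0,4,8,10,15,13] 9, Copy [4,3,8,15,9,0,2,7,10,5,6] 11],
      Copy [0,1,2,3,4,5,14,7,8,9,10] 12, Copy [1,2,11,7,6,0,4,8,10,14,13] 9], Nbr 2 12 [Copy [0,
     4,3,2,1,5,9,8,13,6,10] 14, Copy [0,4,3,2,1,5,9,8,13,6,10] 14, Many 3 [0,1,1,0,1,1,0,0,1,0,
     1,0,1,1,1] [Copy [0,4,12,9,5,1,2,8,10,15,13] 7, Copy [2,3,8,15,7,1,4,9,10,6,5] 12], Copy
     [0,4,3,2,1,5,9,8,13,6,10] 14, Copy [1,2,3,4,0,6,7,8,9,14,10] 11, Copy [0,4,12,9,5,1,2,8,10,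
     14,13] 7]], Nbr 2 12 [Many 3 [0,1,1,0,1,1,0,1,1,0,1,0,1,1] [Copy [0,4,12,9,5,1,2,8,10,14,
     7] 11, Copy [2,3,8,14,7,1,4,9,10,6,5] 13], Copy [0,4,12,9,5,1,2,8,10,13,7] 11], Nbr 6 12
     [Many 4 [1,0,1,1,0,1,2,1,1,1,1,0,1,1] [Copy [0,4,9,12,5,1,14,8,10,6,7] 11, Copy [0,4,9,12,
     14,1,13,8,10,6,7] 11, Copy [0,4,9,12,14,1,13,8,10,6,7] 11, Copy [4,13,14,8,9,0,1,7,10,12,
     6] 11], Copy [0,4,9,12,5,1,13,8,10,6,7] 11, Many 2 [0,1,0,0,1,0,1,0,0,0,1,0,1,1] [Copy [4,
     14,13,8,9,0,1,7,10,12,6] 11, Copy [4,14,13,8,9,0,1,7,10,12,6] 11]], Nbr 7 12 [Many 3 [0,0,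
     1,0,1,1,1,1,1,0,1,0,1,1] [Copy [3,4,9,12,8,2,14,5,10,7,6] 11, Copy [1,0,5,14,6,2,4,9,10,7,
     8] 11, Copy [1,0,5,14,6,2,4,9,10,7,8] 11], Copy [3,4,9,12,8,2,13,5,10,7,6] 11, Many 2 [0,0,
     1,0,1,0,0,1,0,0,1,0,1,1] [Copy [14,13,5,9,4,2,6,10,12,3,7] 11, Copy [3,4,9,12,8,2,14,5,10,
     7,6] 11]], Nbr 4 11 [Copy [0,1,2,3,4,5,6,7,8,12,10] 13, Copy [0,1,2,3,4,5,6,7,8,12,10] 13,
     Copy [0,1,2,3,4,5,6,7,8,12,10] 13, Many 3 [1,0,1,0,1,0,1,0,1,0,1,1,1,1] [Copy [1,2,11,7,6,
     0,4,8,10,14,12] 9, Copy [4,3,8,14,9,0,2,7,10,5,6] 11], Many 3 [1,0,1,1,0,0,1,0,0,1,1,1,1,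
     1] [Copy [1,2,7,14,6,0,3,8,10,5,9] 11, Copy [4,3,8,14,9,0,2,7,10,5,6] 11], Copy [1,2,11,7,
     6,0,4,8,10,13,12] 9], Copy [0,4,9,12,5,1,3,8,10,6,7] 11]),
    (mg_row [10],
     Nbr 6 11 [Nbr 1 12 [Many 2 [0,1,0,1,0,0,1,0,0,0,1,0,1,1] [Copy [14,12,9,8,3,1,5,10,13,2,
     6] 11, Copy [2,3,8,13,7,1,14,9,10,6,5] 11], Copy [2,3,8,13,7,1,4,9,10,6,5] 11], Nbr 2 12
     [Many 2 [1,0,1,0,0,0,0,1,0,0,1,0,1,1] [Copy [0,14,12,9,5,1,2,8,10,13,7] 11, Copy [0,14,12,
     9,5,1,2,8,10,13,7] 11], Copy [0,4,12,9,5,1,2,8,10,13,7] 11], Nbr 0 12 [Many 2 [1,0,1,0,0,1,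
     0,0,0,0,1,0,1,1] [Copy [14,12,8,7,2,0,9,10,13,1,5] 11, Copy [1,2,7,13,6,0,14,8,10,5,9] 11],
      Copy [1,2,7,13,6,0,3,8,10,5,9] 11], Nbr 7 12 [Many 3 [0,0,1,0,1,1,1,1,1,0,1,0,1,1] [Copy
     [3,4,9,12,8,2,14,5,10,7,6] 11, Copy [1,0,5,14,6,2,4,9,10,7,8] 11, Copy [1,0,5,14,6,2,4,9,
     10,7,8] 11], Copy [3,4,9,12,8,2,13,5,10,7,6] 11, Many 2 [0,0,1,0,1,0,0,1,0,0,1,0,1,1]
     [Copy [14,13,5,9,4,2,6,10,12,3,7] 11, Copy [3,4,9,12,8,2,14,5,10,7,6] 11]], Nbr 9 11 [Copy
     [0,1,2,3,4,5,6,7,8,12,10] 13, Copy [0,1,2,3,4,5,6,7,8,12,10] 13, Copy [0,1,2,3,4,5,6,7,8,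
     12,10] 13, Copy [0,1,2,3,4,5,6,7,8,12,10] 13, Many 4 [1,0,1,1,0,1,1,1,1,1,1,1,1,1]
     [Nbr 5 11 [Copy [0,1,6,13,14,4,11,7,10,12,8] 15, Copy [0,4,9,12,14,1,11,8,10,13,7] 15,
     Copy [14,13,15,10,12,0,1,7,8,9,11] 3, Copy [14,13,10,15,12,0,6,7,8,4,11] 1, Copy [1,2,3,4,
     0,6,7,8,9,14,10] 15, Copy [14,13,15,10,12,0,1,7,8,9,11] 3, Copy [1,2,3,4,0,6,7,8,9,14,
     10] 15, Copy [14,13,10,15,12,0,6,7,8,4,11] 2, Copy [0,4,9,12,14,1,11,8,15,13,7] 2]], Copy
     [0,1,2,3,4,5,6,7,8,12,10] 13, Copy [0,1,2,3,4,5,6,7,8,12,10] 13, Many 4 [1,1,0,1,0,1,1,1,1,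
     1,1,1,1,1] [Nbr 8 11 [Copy [3,2,7,13,14,4,11,6,10,12,5] 15, Copy [2,3,8,14,13,1,11,9,10,15,
     5] 4, Copy [4,3,8,14,12,0,11,7,10,15,6] 2, Copy [0,1,2,3,4,5,6,7,14,9,10] 15, Copy [13,15,
     10,12,14,2,6,5,9,3,11] 0, Copy [3,4,9,12,14,2,11,5,10,13,6] 15, Copy [0,1,2,3,4,5,6,7,14,9,
     10] 15, Copy [14,12,15,10,13,3,4,5,6,7,11] 1, Copy [3,4,9,12,14,2,11,5,15,13,6] 0]], Copy
     [1,2,7,13,6,0,3,8,10,5,9] 11], Nbr 1 12 [Many 2 [0,1,0,0,1,0,1,0,0,0,1,0,1,1] [Copy [4,14,
     12,8,9,0,1,7,10,13,6] 11, Copy [4,14,12,8,9,0,1,7,10,13,6] 11], Copy [4,3,12,8,9,0,1,7,10,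
     13,6] 11], Nbr 5 12 [Many 3 [1,0,0,1,0,1,1,1,0,1,1,0,1,1] [Copy [4,3,8,12,9,0,14,7,10,5,
     6] 11, Copy [1,2,7,14,6,0,3,8,10,5,9] 11, Copy [1,2,7,14,6,0,3,8,10,5,9] 11], Copy [4,3,8,
     12,9,0,13,7,10,5,6] 11, Many 2 [1,0,0,1,0,1,0,0,0,0,1,0,1,1] [Copy [14,13,7,8,3,0,6,10,12,
     4,5] 11, Copy [4,3,8,12,9,0,14,7,10,5,6] 11]], Nbr 8 11 [Copy [0,1,2,3,4,5,6,7,12,9,10] 13,
      Copy [0,1,2,3,4,5,6,7,12,9,10] 13, Copy [0,1,2,3,4,5,6,7,12,9,10] 13, Copy [0,1,2,3,4,5,6,
     7,12,9,10] 13, Many 4 [1,0,1,0,1,1,1,1,1,1,1,1,1,1] [Nbr 7 11 [Copy [2,1,6,13,14,3,11,5,10,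
     12,9] 15, Copy [1,2,7,14,13,0,11,8,10,15,9] 3, Copy [2,3,8,12,14,1,11,9,10,13,5] 15, Copy
     [0,4,3,2,1,5,9,8,14,6,10] 15, Copy [13,14,12,10,15,1,2,8,9,5,11] 4, Copy [2,3,8,12,14,1,11,
     9,10,13,5] 15, Copy [0,4,3,2,1,5,9,8,14,6,10] 15, Copy [14,13,10,15,12,2,6,5,9,3,11] 0,
     Copy [0,4,9,15,5,1,3,8,10,6,7] 11]], Copy [0,1,2,3,4,5,6,7,12,9,10] 13, Copy [0,1,2,3,4,5,
     6,7,12,9,10] 13, Many 4 [0,1,1,0,1,1,1,1,1,1,1,1,1,1] [Nbr 9 11 [Copy [13,15,10,12,14,0,6,
     7,8,4,11] 2, Copy [4,3,8,12,14,0,11,7,10,13,6] 15, Copy [4,0,5,13,14,3,11,6,10,12,7] 15,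
     Copy [0,1,2,3,4,5,6,7,8,14,10] 15, Copy [13,15,10,12,14,0,6,7,8,4,11] 2, Copy [4,3,8,12,14,
     0,11,7,10,13,6] 15, Copy [0,1,2,3,4,5,6,7,8,14,10] 15, Copy [12,14,13,10,15,3,4,5,6,7,
     11] 1, Copy [4,3,8,12,14,0,11,7,15,13,6] 1]], Copy [1,0,5,13,6,2,4,9,10,7,8] 11], Copy [4,
     3,8,12,9,0,2,7,10,5,6] 11])]"


definition mg_traces :: "bool list list" where
  "mg_traces = filter (\<lambda>t. list_ex (\<lambda>is. map ((!) t) is \<in> set
     [mg_row [0, 1, 2, 3, 4], mg_row [0, 1, 5, 6], mg_row [5, 6, 10], mg_row [4, 0, 1, 5],
      mg_row [0, 5, 6], mg_row [0, 1, 5], mg_row [5, 10]]) dihedral) (extensions mg_rows [])"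

text \<open>Each of the thirteen certificates removes one dihedral orbit; the seven orbits of
  \<open>mg_traces\<close> survive.\<close>

lemma sieve_trace_certs: "sieve (extensions mg_rows []) trace_certs = mg_traces"
  by code_simp

text \<open>The first three orbits are those of the traces of c, b_j and a_j themselves; the fourth
  belongs to the role of y.\<close>

definition mg_traces_no_z :: "bool list list" where
  "mg_traces_no_z = filter (\<lambda>t. list_ex (\<lambda>is. map ((!) t) is \<in> set
     [mg_row [0, 1, 2, 3, 4], mg_row [0, 1, 5, 6], mg_row [5, 6, 10], mg_row [4, 0, 1, 5]]) dihedral) (extensions mg_rows [])"

text \<open>Once {b_0, c} is excluded as a trace on every copy, two further orbits can be
  refuted.\<close>

lemma sieve_no_z: "sieve (remove_class mg_traces (mg_row [5, 10]))
   [(mg_row [0, 5, 6],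
     Many 2 [1,0,1,0,0,0,1,0,0,1,1,1] [Copy [0,12,2,3,4,5,6,7,11,9,10] 1,
       Nbr 1 11 [Copy [4,3,8,12,9,0,2,7,10,5,6] 13, Copy [4,3,11,12,9,0,2,7,10,13,6] 8]]),
    (mg_row [0, 1, 5],
     Nbr 6 11 [Copy [2,3,8,11,7,1,12,9,10,6,5] 4])] = mg_traces_no_z"
  by code_simp

text \<open>
  The traces that remain once the copy is rotated such that {b_0, c} or else {b_0, a_4, a_0, a_1} is a
  trace, provided that one of their images under the dihedral group is. In the Vega graph,
  c, b_0, b_2, b_3, a_1, a_4, a_0 play the roles of a, u, b, c, v, w, x, while a_2, a_3 and b_4 and b_1
  belong to the neighbourhoods of a and u, of b and v, and of c and w, respectively.
\<close>

definition vega_traces :: "bool list list" where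
  "vega_traces =
   [mg_row [0, 1, 2, 3, 4],
    mg_row [7, 8, 2, 3], mg_row [8, 9, 3, 4], mg_row [9, 5, 4, 0], mg_row [5, 6, 0, 1], mg_row [6, 7, 1, 2],
    mg_row [10, 7, 8], mg_row [10, 8, 9], mg_row [10, 9, 5], mg_row [10, 5, 6], mg_row [10, 6, 7],
    mg_row [5, 10], mg_row [5, 4, 0, 1], mg_row [7, 1, 2, 3], mg_row [8, 2, 3, 4],
    mg_row [1, 6, 7], mg_row [4, 9, 8], mg_row [2, 7, 1], mg_row [3, 8, 4]]"

text \<open>It suffices to refute one trace of each pair exchanged by the reflection, as S is invariant under it.\<close>

definition focuses :: "bool list list \<Rightarrow> bool list \<Rightarrow> bool list list \<Rightarrow> cert list \<Rightarrow> bool" where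
  "focuses A S R cs \<longleftrightarrow> map ((!) S) reflection = S \<and>
     refutes_all A [S] (concat (map (extensions [S]) R)) cs \<and>
     list_all (\<lambda>t. t \<in> set vega_traces \<or> t \<in> set R \<or> map ((!) t) reflection \<in> set R) A"

text \<open>One of each mirror pair of the traces in \<open>mg_traces\<close> that lie outside
  \<open>vega_traces\<close>.\<close>

definition z_excluded :: "bool list list" where
  "z_excluded =
   [mg_row [9, 10],
    mg_row [8, 10],
    mg_row [4, 5, 9],
    mg_row [3, 8, 9],
    mg_row [3, 7, 8],
    mg_row [3, 4, 9],
    mg_row [2, 3, 8],
    mg_row [0, 5, 9],
    mg_row [0, 4, 9],
    mg_row [0, 4, 5],
    mg_row [0, 3, 4, 9]]"
text \<open>The entries follow \<open>z_excluded\<close>, each trace being prolonged first by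
  non-adjacency and then, where possible, by adjacency to the vertex with trace {b_0, c}.\<close>

definition z_certs :: "cert list" where
  "z_certs =
   [Many 3 [0,1,0,0,1,1,1,1,1,1,1,1,0] [Nbr 3 13 [Many 2 [1,0,0,1,0,0,0,0,1,0,1,0,0,1,1] [Copy [15,
      13,6,5,0,3,7,10,14,4,8] 11, Copy [4,0,5,14,9,3,15,6,10,8,7] 11], Many 4 [2,0,0,2,0,0,0,0,2,0,2,
      0,0,2,2] [Copy [15,13,6,5,0,3,7,10,14,4,8] 11, Copy [4,0,5,14,9,3,15,6,10,8,7] 11], Copy [0,4,9,
      14,5,1,3,8,10,6,7] 11, Copy [0,4,9,14,5,1,3,8,10,6,7] 11], Nbr 6 11 [Copy [0,1,2,3,4,5,13,7,8,9,
      10] 14, Copy [0,1,2,3,4,5,13,7,8,9,10] 14, Copy [0,4,9,14,5,1,11,8,10,13,7] 2, Copy [0,4,9,14,5,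
      1,11,8,10,13,7] 2, Copy [0,1,2,3,4,5,13,7,8,9,10] 14, Copy [0,1,2,3,4,5,13,7,8,9,10] 14, Copy
      [0,4,9,14,5,1,11,8,10,13,7] 12, Copy [0,1,6,13,5,4,11,7,10,14,8] 12, Copy [0,1,2,3,4,5,13,7,8,9,
      10] 14, Copy [0,1,2,3,4,5,13,7,8,9,10] 14, Copy [4,3,8,14,9,0,2,7,10,5,6] 12, Copy [4,3,8,14,9,
      0,2,7,10,5,6] 13], Copy [0,1,11,3,4,5,6,7,8,13,10] 12, Nbr 2 13 [Many 2 [1,0,1,0,0,0,0,1,0,0,1,
      0,0,1,1] [Copy [0,15,13,9,5,1,2,8,10,14,7] 11, Copy [0,15,13,9,5,1,2,8,10,14,7] 11], Copy [0,4,
      13,9,5,1,2,8,10,14,7] 11], Copy [0,1,2,3,4,5,6,7,8,13,10] 12, Nbr 9 11 [Copy [0,4,9,13,5,1,11,8,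
      10,14,7] 3, Copy [0,1,2,3,4,5,6,7,8,13,10] 14, Copy [0,1,2,3,4,5,6,7,8,13,10] 14, Copy [0,1,6,
      14,5,4,11,7,10,13,8] 12, Copy [0,1,2,3,4,5,6,7,8,13,10] 14, Copy [1,2,7,14,6,0,3,8,10,5,9] 13]],
    Many 3 [0,0,1,0,1,1,1,1,1,1,1,0,1] [Nbr 0 13 [Many 2 [1,0,0,1,0,1,0,0,0,0,1,0,0,1,1] [Copy [15,
      13,7,8,3,0,6,10,14,4,5] 12, Copy [4,3,8,14,9,0,15,7,10,5,6] 11], Copy [11,13,7,8,3,0,6,10,14,4,
      5] 12, Copy [4,3,8,14,9,0,2,7,10,5,6] 11, Copy [4,3,8,14,9,0,2,7,10,5,6] 12], Nbr 1 13 [Many 2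
      [0,1,0,1,0,0,1,0,0,0,1,0,0,1,1] [Copy [15,13,9,8,3,1,5,10,14,2,6] 11, Copy [2,3,8,14,7,1,15,9,
      10,6,5] 12], Copy [2,3,8,14,7,1,4,9,10,6,5] 12], Copy [0,12,11,3,4,5,6,7,8,13,10] 9, Nbr 9 12
      [Copy [3,4,9,13,8,2,12,5,10,14,6] 0, Copy [0,1,2,3,4,5,6,7,8,13,10] 14, Copy [0,1,2,3,4,5,6,7,8,
      13,10] 14, Copy [0,1,2,3,4,5,6,7,8,13,10] 14, Copy [0,1,2,3,4,5,6,7,8,13,10] 14, Copy [0,1,2,3,
      4,5,6,7,8,13,10] 14, Copy [3,4,9,13,8,2,12,5,10,14,6] 11, Copy [1,2,7,14,6,0,3,8,10,5,9] 11,
      Copy [1,2,7,14,6,0,3,8,10,5,9] 13], Copy [0,12,11,3,4,5,6,7,8,13,10] 9, Nbr 7 12 [Copy [3,4,9,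
      14,8,2,12,5,10,13,6] 1, Copy [3,4,9,14,8,2,12,5,10,13,6] 1, Copy [0,4,3,2,1,5,9,8,13,6,10] 14,
      Copy [0,4,3,2,1,5,9,8,13,6,10] 14, Copy [0,4,3,2,1,5,9,8,13,6,10] 14, Copy [0,12,11,3,4,5,6,7,8,
      14,10] 9, Copy [0,4,3,2,1,5,9,8,13,6,10] 14, Copy [0,4,3,2,1,5,9,8,13,6,10] 14, Copy [3,4,9,14,
      8,2,12,5,10,13,6] 11, Copy [0,12,11,3,4,5,6,7,8,14,10] 9, Copy [0,4,9,14,5,1,3,8,10,6,7] 11,
      Copy [0,4,9,14,5,1,3,8,10,6,7] 13]],
    Nbr 0 12 [Many 3 [1,1,0,1,0,1,0,1,0,1,1,0,1,1] [Copy [4,3,8,13,9,0,14,7,10,5,6] 11, Copy [0,4,9,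
      14,5,1,3,8,10,6,7] 11, Copy [0,4,9,14,5,1,3,8,10,6,7] 12], Many 2 [0,1,0,0,1,1,0,0,1,0,1,0,1,0]
      [Copy [11,12,7,8,3,0,6,10,13,4,5] 14, Copy [14,1,2,3,4,5,6,7,8,9,10] 13, Copy [11,12,14,8,3,0,6,
      10,13,4,5] 9], Copy [4,3,8,13,9,0,2,7,10,5,6] 11, Many 2 [0,1,0,0,1,1,0,0,1,0,1,0,1,0] [Copy [4,
      3,8,13,9,0,2,7,10,5,6] 14, Copy [14,4,3,11,0,5,13,8,12,6,10] 9, Copy [11,12,14,8,3,0,6,10,13,4,
      5] 9]],
    Nbr 4 12 [Many 2 [0,0,1,0,1,0,0,0,0,1,1,0,1,1] [Copy [2,14,12,6,7,3,4,5,10,13,9] 11, Copy [2,14,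
      12,6,7,3,4,5,10,13,9] 11], Copy [2,1,12,6,7,3,4,5,10,13,9] 11],
    Many 2 [1,0,0,1,0,0,0,1,0,1,1,0,1] [Copy [0,1,2,11,13,5,12,7,8,9,10] 6, Nbr 4 12 [Copy [0,1,2,3,
      13,5,6,7,8,9,10] 14, Copy [0,1,2,11,13,5,12,7,14,9,10] 6], Copy [1,2,7,13,6,0,3,8,10,5,9] 11,
      Nbr 4 12 [Copy [1,2,7,13,6,0,3,8,10,5,9] 14, Copy [1,12,13,7,2,0,5,10,14,11,9] 6]],
    Many 2 [0,1,0,1,0,0,0,1,0,1,1,0,1] [Copy [1,13,3,4,0,6,7,8,9,12,10] 11, Copy [1,13,3,4,0,6,7,8,
      9,12,10] 11, Copy [0,4,9,13,5,1,3,8,10,6,7] 11, Copy [0,4,9,13,12,1,3,8,10,6,7] 11],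
    Nbr 2 12 [Many 3 [1,0,1,0,1,0,1,1,1,0,1,0,1,1] [Copy [3,4,9,13,8,2,14,5,10,7,6] 11, Copy [4,3,8,
      14,9,0,2,7,10,5,6] 11], Copy [4,3,8,13,9,0,2,7,10,5,6] 11],
    Nbr 8 12 [Many 3 [0,0,1,0,1,1,1,1,1,1,1,0,0,1] [Copy [2,1,6,12,14,3,13,5,10,8,9] 0, Copy [0,13,
      2,3,4,5,6,7,8,14,10] 12, Copy [0,13,2,3,4,5,6,7,8,14,10] 12, Copy [0,1,2,3,4,5,6,7,8,14,10] 12,
      Copy [0,1,2,3,4,5,6,7,8,14,10] 12, Copy [2,1,6,12,14,3,13,5,10,8,9] 11], Copy [2,1,6,12,7,3,13,
      5,10,8,9] 11, Many 2 [0,1,0,1,0,0,0,0,1,0,1,0,1,1] [Copy [1,14,13,5,6,2,3,9,10,12,8] 11, Copy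
      [1,14,13,5,6,2,3,9,10,12,8] 11], Many 3 [0,1,0,1,1,1,0,1,1,0,1,0,1,1] [Copy [2,1,6,12,7,3,14,5,
      10,8,9] 11, Copy [2,3,8,14,7,1,4,9,10,6,5] 13]],
    Many 3 [1,1,0,1,0,1,0,1,1,1,1,0,1] [Nbr 0 12 [Copy [13,1,2,3,4,5,6,7,8,9,10] 14, Copy [2,1,6,12,
      7,3,13,5,10,8,9] 14, Copy [2,3,14,8,7,1,13,9,10,12,5] 6, Copy [0,1,2,11,13,5,12,7,14,9,10] 6,
      Copy [4,3,8,14,9,0,2,7,10,5,6] 11], Copy [0,1,2,11,4,5,12,7,13,9,10] 6, Nbr 8 12 [Copy [0,1,2,3,
      4,5,6,7,13,9,10] 14, Copy [0,1,2,11,14,5,12,7,13,9,10] 6, Copy [0,1,2,3,4,5,6,7,13,9,10] 14]],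
    Many 3 [1,0,1,0,1,0,1,1,1,1,1,0,1] [Copy [1,0,5,12,6,2,13,9,10,7,8] 11, Copy [1,2,3,4,0,6,13,8,
      9,12,10] 11, Many 4 [0,1,0,1,1,1,1,1,1,1,1,1,1,1] [Copy [1,2,7,13,14,0,11,8,10,5,9] 12, Copy [0,
      1,11,3,4,5,6,7,8,14,10] 13], Copy [1,2,3,4,0,6,13,8,9,12,10] 11],
    Many 3 [1,0,1,0,1,0,1,1,1,1,1,0,1] [Nbr 4 12 [Copy [0,1,2,3,13,5,6,7,8,9,10] 14, Copy [1,2,14,7,
      6,0,13,8,10,12,9] 5, Copy [1,0,5,12,6,2,13,9,10,7,8] 14, Copy [1,2,14,7,6,0,13,8,10,12,9] 11,
      Copy [2,3,8,14,7,1,4,9,10,6,5] 12], Nbr 7 12 [Many 4 [0,1,0,1,1,1,1,1,1,1,1,0,1,1,1] [Copy [1,2,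
      13,7,15,0,14,8,10,12,9] 5, Copy [1,2,13,7,15,0,14,8,10,12,9] 5, Copy [14,1,2,3,4,5,6,7,15,9,
      10] 12], Copy [1,2,13,7,6,0,14,8,10,12,9] 5, Many 2 [1,0,1,0,0,0,0,1,0,0,1,0,1,0,1] [Copy [15,2,
      13,8,14,0,1,7,10,9,12] 5, Copy [15,2,13,8,14,0,1,7,10,9,12] 5]], Nbr 7 12 [Copy [0,4,3,2,1,5,9,
      8,13,6,10] 14, Copy [1,2,13,7,6,0,14,8,10,12,9] 11, Copy [0,4,3,2,1,5,9,8,13,6,10] 14]],
    Nbr 4 12 [Many 2 [0,1,0,0,1,0,0,0,0,1,1,0,1,1] [Copy [1,14,12,7,6,0,4,8,10,13,9] 11, Copy [1,14,
      12,7,6,0,4,8,10,13,9] 11], Many 2 [0,1,0,0,1,0,0,0,0,1,1,0,1,1] [Copy [1,14,12,7,6,0,4,8,10,13,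
      9] 11, Copy [1,14,12,7,6,0,4,8,10,13,9] 11], Copy [1,2,12,7,6,0,4,8,10,13,9] 11, Copy [1,2,12,7,
      6,0,4,8,10,13,9] 11],
    Nbr 5 12 [Many 3 [1,0,1,0,0,1,1,0,1,1,1,0,1,1] [Copy [1,2,7,12,6,0,14,8,10,5,9] 11, Copy [4,3,8,
      14,9,0,2,7,10,5,6] 11, Many 3 [1,0,0,1,0,1,1,1,0,1,0,0,1,1,1] [Copy [0,15,5,9,4,2,6,10,14,3,
      7] 12, Copy [1,2,7,15,6,0,3,8,10,5,9] 11, Copy [11,3,8,7,2,0,9,14,15,6,5] 12]], Copy [1,2,7,12,
      6,0,13,8,10,5,9] 11, Many 3 [1,0,1,0,1,1,1,0,1,0,1,0,1,1] [Copy [1,2,7,12,6,0,14,8,10,5,9] 11,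
      Copy [1,0,5,14,6,2,4,9,10,7,8] 11, Copy [1,0,5,14,6,2,4,9,10,7,8] 13]],
    Many 3 [0,1,0,0,1,1,1,1,1,1,1,1,0] [Copy [1,2,7,12,13,0,11,8,10,5,9] 3, Nbr 3 12 [Copy [0,1,2,
      11,4,5,13,7,8,9,10] 14, Copy [1,2,7,12,13,0,11,8,10,5,9] 14, Copy [1,2,7,12,13,0,11,8,10,5,
      9] 14, Copy [1,2,3,4,0,6,7,8,9,14,10] 11, Copy [1,2,7,12,13,0,11,8,10,5,9] 14], Copy [0,1,11,3,
      4,5,6,7,8,13,10] 12, Copy [0,1,2,3,4,5,6,7,8,13,10] 12],
    Many 3 [0,1,1,0,1,1,1,0,1,1,1,0,1] [Nbr 1 12 [Copy [0,13,2,3,4,5,6,7,8,9,10] 14, Copy [0,13,2,3,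
      4,5,6,7,8,9,10] 14, Copy [3,2,7,12,8,4,13,6,10,9,5] 14, Copy [3,2,7,12,8,4,13,6,10,9,5] 14,
      Copy [3,4,14,9,8,2,13,5,10,12,6] 7, Copy [3,4,14,9,8,2,13,5,10,12,6] 7, Copy [3,4,14,9,8,2,13,5,
      10,12,6] 11, Copy [0,4,3,11,1,5,14,8,12,6,10] 9, Copy [0,4,9,14,5,1,3,8,10,6,7] 11, Copy [0,4,9,
      14,5,1,3,8,10,6,7] 12], Many 4 [1,1,1,0,1,1,1,1,1,1,1,0,1,1] [Nbr 9 12 [Copy [0,1,2,3,4,5,6,7,8,
      14,10] 15, Copy [3,4,13,9,8,2,15,5,10,12,6] 7, Copy [0,1,2,3,4,5,6,7,8,14,10] 15, Copy [0,1,2,3,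
      4,5,6,7,8,14,10] 15], Copy [0,1,11,3,4,5,6,7,8,14,10] 13, Nbr 9 12 [Copy [0,4,3,2,1,5,13,8,14,6,
      10] 15, Copy [3,4,13,9,8,2,15,5,10,12,6] 7, Copy [0,4,3,2,1,5,13,8,14,6,10] 15, Copy [0,4,3,2,1,
      5,13,8,14,6,10] 15]], Copy [0,4,3,11,1,5,13,8,12,6,10] 9, Nbr 9 12 [Copy [0,1,2,3,4,5,6,7,8,13,
      10] 14, Copy [3,4,13,9,8,2,14,5,10,12,6] 11, Copy [0,1,2,3,4,5,6,7,8,13,10] 14, Copy [0,1,2,3,4,
      5,6,7,8,13,10] 14], Copy [0,4,3,11,1,5,13,8,12,6,10] 9],
    Copy [1,2,7,12,6,0,3,8,10,5,9] 11,
    Many 3 [0,1,0,0,1,1,1,1,1,1,1,1,0] [Nbr 3 13 [Copy [1,2,7,12,13,0,11,8,10,5,9] 14, Copy [5,6,12,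
      10,14,0,1,7,8,9,3] 11], Nbr 6 11 [Copy [1,2,7,12,6,0,3,8,10,5,9] 14, Copy [5,13,12,10,14,0,1,7,
      8,9,11] 2, Copy [1,2,7,12,6,0,3,8,10,5,9] 14, Copy [5,13,12,10,14,0,1,7,8,9,11] 3, Copy [1,2,7,
      12,13,0,3,8,10,5,9] 14, Copy [4,3,8,14,9,0,2,7,10,5,6] 13], Copy [1,2,7,12,6,0,3,8,10,5,9] 13,
      Copy [1,2,7,12,6,0,3,8,10,5,9] 13]]"


lemma focuses_z: "focuses mg_traces (mg_row [5, 10]) z_excluded z_certs"
  by code_simp

lemma focuses_y: "focuses mg_traces_no_z (mg_row [5, 4, 0, 1]) [mg_row [6, 0, 1, 2]]
   [Copy [4,3,8,12,9,0,2,7,10,5,6] 11]"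
  by code_simp

text \<open>Without a vertex in the role of y only the traces of the vertices of \<Upsilon> are
  left, so any copy will do.\<close>

lemma remove_y: "list_all (\<lambda>t. t \<in> set vega_traces) (remove_class mg_traces_no_z (mg_row [5, 4, 0, 1]))"
  by code_simp

lemma dihedral_copies: "list_all (copy_at mg_rows [] mg_rows) dihedral"
  and reflection_dihedral: "reflection \<in> set dihedral"
  by code_simp+

section \<open>Choosing a suitable copy of \<Upsilon>\<close>

context mtf_graph
begin

lemma excluded:
  assumes "traces_in A" "realizes f (mg_rows @ xs)"
    "refutes_all A xs (concat (map (extensions xs) R)) cs" "y \<in> V"
  shows "trace f 11 y \<notin> set R"
proof
  assume "trace f 11 y \<in> set R"
  moreover have "trace f (length (mg_rows @ xs)) y \<in> set (extensions xs (trace f 11 y))"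
    using trace_in_extensions[OF assms(2), of 11 y] by simp
  ultimately have "trace f (length (mg_rows @ xs)) y \<in> set (concat (map (extensions xs) R))"
    by auto
  then show False using refutes_sound(2)[OF assms] by blast
qed

lemma traces_in_all: "traces_in (extensions mg_rows [])"
  unfolding traces_in_def
proof (intro allI impI)
  fix g y assume "mg_copy g \<and> y \<in> V"
  then show "trace g 11 y \<in> set (extensions mg_rows [])"
    using trace_in_extensions[OF mg_copy_realizes, of g 0 y] by (simp add: trace_def)
qed

lemma mg_copy_dihedral:
  assumes "mg_copy g" "is \<in> set dihedral"
  shows "mg_copy (\<lambda>i. g (is ! i))"
    and "trace (\<lambda>i. g (is ! i)) 11 y = map ((!) (trace g 11 y)) is"
proof -
  have c: "copy_at mg_rows [] mg_rows is"
    using dihedral_copies assms(2) by (simp add: list_all_iff)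
  then show "mg_copy (\<lambda>i. g (is ! i))"
    using realizes_copy mg_copy_realizes[OF assms(1)] by blast
  have "length is = 11" "\<And>i. i < 11 \<Longrightarrow> is ! i < 11"
    using copy_at_edges[OF c] by auto
  then show "trace (\<lambda>i. g (is ! i)) 11 y = map ((!) (trace g 11 y)) is"
    by (intro nth_equalityI) auto
qed

text \<open>The image of a trace under a symmetry is the trace of the same vertex on the transformed
  copy, so the whole orbit of S is excluded.\<close>

lemma traces_in_remove_class:
  assumes "traces_in A" "\<And>g y. mg_copy g \<Longrightarrow> y \<in> V \<Longrightarrow> trace g 11 y \<noteq> S"
  shows "traces_in (remove_class A S)"
  using assms mg_copy_dihedral unfolding traces_in_def remove_class_def
  by (simp add: list_all_iff) metis

lemma realizes_trace:
  assumes "mg_copy g" "z \<in> V"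
  shows "realizes (g(11 := z)) (mg_rows @ [trace g 11 z])"
  using realizes_snoc[OF mg_copy_realizes[OF assms(1)] assms(2)] by simp

text \<open>A certificate that fails ends the sieve with the current list, so only justified
  removals are made.\<close>

lemma traces_in_sieve: "traces_in A \<Longrightarrow> traces_in (sieve A ps)"
proof (induction A ps rule: sieve.induct)
  case (2 A S c ps)
  have "traces_in (remove_class A S)" if "refutes A [S] c"
  proof (rule traces_in_remove_class[OF 2(2)])
    fix g y assume g: "mg_copy g" "y \<in> V"
    show "trace g 11 y \<noteq> S"
      using refutes_sound(1)[OF 2(2) realizes_trace[OF g]] that by auto
  qed
  then show ?case using 2 by simp
qed simp

text \<open>As S is invariant, z has trace S on the reflected copy too; hence the traces of y on
  both copies avoid R.\<close>

lemma focuses_sound: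
  assumes "traces_in A" "focuses A S R cs" "mg_copy g" "z \<in> V" "trace g 11 z = S" "y \<in> V"
  shows "trace g 11 y \<in> set vega_traces"
proof -
  have S: "map ((!) S) reflection = S"
    and all: "refutes_all A [S] (concat (map (extensions [S]) R)) cs"
    and A: "list_all (\<lambda>t. t \<in> set vega_traces \<or> t \<in> set R \<or> map ((!) t) reflection \<in> set R) A"
    using assms(2) by (auto simp: focuses_def)
  have ex: "trace h 11 y \<notin> set R" if "mg_copy h" "trace h 11 z = S" for h
    using excluded[OF assms(1) _ all assms(6), of "h(11 := z)"] realizes_trace[OF that(1) assms(4)]
      that(2) trace_upd[of h 11 z y] by simp
  have r: "reflection \<in> set dihedral"
    using reflection_dihedral .
  have "trace (\<lambda>i. g (reflection ! i)) 11 y \<notin> set R"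
    using ex mg_copy_dihedral[OF assms(3) r] assms(5) S by metis
  then have "map ((!) (trace g 11 y)) reflection \<notin> set R"
    using mg_copy_dihedral(2)[OF assms(3) r] by simp
  moreover have "trace g 11 y \<in> set A"
    using assms(1,3,6) by (simp add: traces_in_def)
  ultimately show ?thesis
    using A ex[OF assms(3,5)] unfolding list_all_iff by blast
qed

text \<open>A copy on which {b_0, c} is a trace is preferred, then one on which {b_0, a_4, a_0, a_1}
  is; if neither exists, the given copy is kept.\<close>

lemma exists_vega_copy:
  assumes "mg_copy g\<^sub>0"
  obtains g where "mg_copy g" "\<And>y. y \<in> V \<Longrightarrow> trace g 11 y \<in> set vega_traces"
proof -
  have A: "traces_in mg_traces"
    using traces_in_sieve[OF traces_in_all, of trace_certs] unfolding sieve_trace_certs .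
  consider (z) g z where "mg_copy g" "z \<in> V" "trace g 11 z = mg_row [5, 10]"
    | (no_z) "traces_in (remove_class mg_traces (mg_row [5, 10]))"
    using traces_in_remove_class[OF A] by blast
  then show thesis
  proof cases
    case z
    then show thesis using that focuses_sound[OF A focuses_z] by blast
  next
    case no_z
    then have B: "traces_in mg_traces_no_z"
      using traces_in_sieve unfolding sieve_no_z[symmetric] by blast
    consider (y) g z where "mg_copy g" "z \<in> V" "trace g 11 z = mg_row [5, 4, 0, 1]"
      | (no_y) "traces_in (remove_class mg_traces_no_z (mg_row [5, 4, 0, 1]))"
      using traces_in_remove_class[OF B] by blast
    then show thesis
    proof cases
      case y
      then show thesis using that focuses_sound[OF B focuses_y] by blast
    next
      case no_y
      then show thesis
        using that[OF assms] assms remove_y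
        by (auto simp: traces_in_def list_all_iff)
    qed
  qed
qed

text \<open>D_2 gives a vertex adjacent to at least three of the six terms; by triangle-freeness no
  two cyclically consecutive ones are among them, so they alternate.\<close>

lemma hexagon:
  assumes "E x1 x2" "E x2 x3" "E x3 x4" "E x4 x5" "E x5 x6" "E x6 x1"
  obtains y where "E y x1" "E y x3" "E y x5" | y where "E y x2" "E y x4" "E y x6"
proof -
  have "set [x1, x2, x3, x4, x5, x6] \<subseteq> V" using assms E_in by simp
  then obtain y where "2 < length (filter (E y) [x1, x2, x3, x4, x5, x6])"
    using many_nbrs_list[of 2 "[x1, x2, x3, x4, x5, x6]"] by auto
  moreover have "\<not> (E y p \<and> E y q)" if "E p q" for p q
    using no_triangle[of y p q] that by blast
  note this[OF assms(1)] this[OF assms(2)] this[OF assms(3)] this[OF assms(4)]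
    this[OF assms(5)] this[OF assms(6)]
  ultimately show thesis
    using that by (cases "E y x1"; cases "E y x2"; cases "E y x3"; cases "E y x4") (auto split: if_splits)
qed

end

section \<open>From the classes to a Vega graph\<close>

text \<open>
  Core classes are the parts of \<Gamma>_i, the outer classes are those of a, b, c, the inner classes those of
  u, v, w, and the apex and coapex are x and y. The correspondence between the three roles and the
  three parts of \<Gamma>_i is chosen only in the locale \<open>vega_roles\<close>.
\<close>

datatype role = R1 | R2 | R3

datatype vclass = Core role | Outer role | Inner role | Apex | Coapex

fun class_adj :: "vclass \<Rightarrow> vclass \<Rightarrow> bool" where
  "class_adj (Core i) (Core j) \<longleftrightarrow> i \<noteq> j"
| "class_adj (Core i) (Outer j) \<longleftrightarrow> i = j"
| "class_adj (Core i) (Inner j) \<longleftrightarrow> i = j"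
| "class_adj (Outer i) (Core j) \<longleftrightarrow> i = j"
| "class_adj (Inner i) (Core j) \<longleftrightarrow> i = j"
| "class_adj (Outer i) (Inner j) \<longleftrightarrow> i \<noteq> j"
| "class_adj (Inner i) (Outer j) \<longleftrightarrow> i \<noteq> j"
| "class_adj (Outer i) Apex \<longleftrightarrow> True"
| "class_adj Apex (Outer i) \<longleftrightarrow> True"
| "class_adj (Inner i) Coapex \<longleftrightarrow> True"
| "class_adj Coapex (Inner i) \<longleftrightarrow> True"
| "class_adj Apex Coapex \<longleftrightarrow> True"
| "class_adj Coapex Apex \<longleftrightarrow> True"
| "class_adj _ _ \<longleftrightarrow> False"

section \<open>Adjacency between the classes\<close>

text \<open>Only \<open>Coapex\<close> may be empty; this decides whether y is deleted from the Vega
  graph.\<close>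

locale vega_partition = mtf_graph +
  fixes \<tau> :: "'a \<Rightarrow> vclass"
  assumes finite: "finite V"
    and adj_class: "E p q \<Longrightarrow> class_adj (\<tau> p) (\<tau> q)"
    and inhabited: "s \<noteq> Coapex \<Longrightarrow> \<exists>p\<in>V. \<tau> p = s"
begin

lemma other_role: "i \<noteq> j \<Longrightarrow> j \<noteq> l \<Longrightarrow> i \<noteq> l \<Longrightarrow> r = i \<or> r = j \<or> r = (l :: role)"
  by (cases i; cases j; cases l; cases r) auto

text \<open>The three cores form the only triangle of \<open>class_adj\<close>, so p and q can have
  no common neighbour and are adjacent by maximality.\<close>

lemma adj_complete:
  assumes "p \<in> V" "q \<in> V" "class_adj (\<tau> p) (\<tau> q)" "\<And>i j. \<not> (\<tau> p = Core i \<and> \<tau> q = Core j)"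
  shows "E p q"
proof (rule ccontr)
  assume "\<not> E p q"
  then obtain z where "E z p" "E z q" using common_nbr assms(1,2) by blast
  then have "class_adj (\<tau> z) (\<tau> p)" "class_adj (\<tau> z) (\<tau> q)" using adj_class by blast+
  then show False using assms(3,4) by (cases "\<tau> p"; cases "\<tau> q"; cases "\<tau> z") auto
qed

text \<open>The third core is the only class compatible with two different cores.\<close>

lemma core_common_nbr:
  assumes "\<tau> p = Core i" "\<tau> q = Core j" "p \<in> V" "q \<in> V" "\<not> E p q" "i \<noteq> j" "j \<noteq> l" "i \<noteq> l"
  obtains z where "\<tau> z = Core l" "E z p" "E z q"
proof -
  obtain z where z: "E z p" "E z q" using common_nbr assms(3-5) by blast
  then have "class_adj (\<tau> z) (Core i)" "class_adj (\<tau> z) (Core j)" using adj_class assms(1,2) by metis+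
  then have "\<tau> z = Core l" using assms(6) other_role[OF assms(6-8)] by (cases "\<tau> z") auto
  then show thesis using z that by blast
qed

lemma not_class_adj_cores:
  assumes "i \<noteq> j" "j \<noteq> l" "i \<noteq> l" "class_adj s (Core i)" "class_adj s (Core j)" "class_adj s (Core l)"
  shows False
  using assms(4-) other_role[OF assms(1-3)] by (cases s) (auto simp: assms)

text \<open>Either alternating triple of the walk meets all three cores, but no class is compatible
  with all of them.\<close>

lemma core_hexagon:
  assumes "E x1 x2" "E x2 x3" "E x3 x4" "E x4 x5" "E x5 x6" "E x6 x1" "i \<noteq> j" "j \<noteq> l" "i \<noteq> l"
    "\<tau> x1 = Core i" "\<tau> x3 = Core j" "\<tau> x5 = Core l" "\<tau> x2 = Core l" "\<tau> x4 = Core i" "\<tau> x6 = Core j"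
  shows False
  using hexagon[OF assms(1-6)] not_class_adj_cores[OF assms(7-9)] adj_class assms(10-) by metis

section \<open>Ordering the three cores\<close>

text \<open>In the Vega graph, 0 and 2i-1 have no neighbours among 2i, ..., 3i-2; such asymmetries
  reveal which core plays which part.\<close>

definition blind :: "role \<Rightarrow> role \<Rightarrow> bool" where
  "blind i j \<longleftrightarrow> (\<exists>p\<in>V. \<tau> p = Core i \<and> (\<forall>q. \<tau> q = Core j \<longrightarrow> \<not> E p q))"

text \<open>A vertex seeing both an outer and an inner vertex of one role lies in the core of that
  role. So the vertex given by \<open>hexagon\<close> is a neighbour that p or q was assumed to
  lack.\<close>

lemma blind_asym:
  assumes "i \<noteq> j" "blind i j"
  shows "\<not> blind j i"
proof
  assume "blind j i"
  then obtain q where q: "q \<in> V" "\<tau> q = Core j" "\<And>z. \<tau> z = Core i \<Longrightarrow> \<not> E q z"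
    by (auto simp: blind_def)
  obtain p where p: "p \<in> V" "\<tau> p = Core i" "\<And>z. \<tau> z = Core j \<Longrightarrow> \<not> E p z"
    using assms(2) by (auto simp: blind_def)
  obtain a b u v where h: "a \<in> V" "\<tau> a = Outer i" "b \<in> V" "\<tau> b = Outer j"
    "u \<in> V" "\<tau> u = Inner i" "v \<in> V" "\<tau> v = Inner j"
    using inhabited by (metis vclass.distinct)
  \<comment> \<open>a closed walk of length six, to which D_2 applies\<close>
  have "E u b" "E b q" "E q v" "E v a" "E a p" "E p u"
    by (rule adj_complete; use h p q assms(1) in simp)+
  then consider y where "E y u" "E y q" "E y a" | y where "E y b" "E y v" "E y p"
    by (rule hexagon)
  then show False
  proof cases
    case (1 y)
    then have "\<tau> y = Core i"
      using adj_class[of y u] adj_class[of y a] h by (cases "\<tau> y") auto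
    then show False using 1 q E_sym by blast
  next
    case (2 y)
    then have "\<tau> y = Core j"
      using adj_class[of y b] adj_class[of y v] h by (cases "\<tau> y") auto
    then show False using 2 p E_sym by blast
  qed
qed

text \<open>The two witnesses r and q would be non-adjacent, so they would have a common neighbour
  in the third core, where q has no neighbour.\<close>

lemma blind_not_trans:
  assumes "i \<noteq> j" "j \<noteq> l" "i \<noteq> l" "blind j i"
  shows "\<not> blind l j"
proof
  assume "blind l j"
  then obtain r where r: "r \<in> V" "\<tau> r = Core l" "\<And>z. \<tau> z = Core j \<Longrightarrow> \<not> E r z"
    by (auto simp: blind_def)
  obtain q where q: "q \<in> V" "\<tau> q = Core j" "\<And>z. \<tau> z = Core i \<Longrightarrow> \<not> E q z"
    using assms(4) by (auto simp: blind_def)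
  have "\<not> E r q" using r q by blast
  then obtain z where "\<tau> z = Core i" "E z r" "E z q"
    using core_common_nbr[OF r(2) q(2) r(1) q(1)] assms by metis
  then show False using q E_sym by blast
qed

text \<open>The blind pairs form an acyclic relation, and the roles are a topological order of it.\<close>

lemma exists_roles:
  obtains i j l where "i \<noteq> j" "j \<noteq> l" "i \<noteq> l" "\<not> blind j i" "\<not> blind l i" "\<not> blind l j"
proof -
  note d = role.distinct
  note asym = blind_asym[OF d(1)] blind_asym[OF d(3)] blind_asym[OF d(5)]
  note trans = blind_not_trans[OF d(1,5,3)] blind_not_trans[OF d(3,6,1)] blind_not_trans[OF d(2,3,5)]
    blind_not_trans[OF d(5,4,2)] blind_not_trans[OF d(4,1,6)] blind_not_trans[OF d(6,2,4)]
  note t = that[OF d(1,5,3)] that[OF d(3,6,1)] that[OF d(2,3,5)] that[OF d(5,4,2)]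
    that[OF d(4,1,6)] that[OF d(6,2,4)]
  show thesis
    using asym trans t by satx
qed

end

section \<open>Ranks in the chain of neighbourhoods\<close>

locale vega_roles = vega_partition +
  fixes i j l :: role
  assumes distinct: "i \<noteq> j" "j \<noteq> l" "i \<noteq> l"
    and not_blind: "\<not> blind j i" "\<not> blind l i" "\<not> blind l j"
begin

definition A where "A = {p \<in> V. \<tau> p = Core i}"
definition B where "B = {p \<in> V. \<tau> p = Core j}"
definition C where "C = {p \<in> V. \<tau> p = Core l}"

definition nbC :: "'a \<Rightarrow> 'a set" where "nbC p = {r \<in> C. E p r}"

text \<open>
  The chain of the sets \<open>nbC p\<close> has k members; \<alpha> is the rank in it, \<beta> and \<gamma> count the members whose
  vertices are adjacent, respectively non-adjacent, to the argument.
\<close>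

definition k :: nat where "k = card (nbC ` A)"
definition \<alpha> :: "'a \<Rightarrow> nat" where "\<alpha> p = card {S \<in> nbC ` A. S \<subset> nbC p}"
definition \<beta> :: "'a \<Rightarrow> nat" where "\<beta> q = card (nbC ` {p \<in> A. E p q})"
definition \<gamma> :: "'a \<Rightarrow> nat" where "\<gamma> r = card {S \<in> nbC ` A. r \<notin> S}"

lemma fin: "finite A" "finite (nbC ` A)"
  using finite by (auto simp: A_def)

text \<open>If r and r' witness incomparability, common neighbours of p, r' and of p', r in B
  complete a closed walk through A, C, B, A, C, B, against \<open>core_hexagon\<close>.\<close>

lemma nbC_chain:
  assumes "p \<in> A" "p' \<in> A"
  shows "nbC p \<subseteq> nbC p' \<or> nbC p' \<subseteq> nbC p"
proof (rule ccontr)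
  assume "\<not> ?thesis"
  then obtain r r' where r: "r \<in> C" "E p r" "\<not> E p' r" and r': "r' \<in> C" "E p' r'" "\<not> E p r'"
    by (auto simp: nbC_def)
  obtain s where s: "\<tau> s = Core j" "E s p" "E s r'"
    using core_common_nbr[of p i r' l j] r' assms distinct by (auto simp: A_def C_def)
  obtain t where t: "\<tau> t = Core j" "E t p'" "E t r"
    using core_common_nbr[of p' i r l j] r assms distinct by (auto simp: A_def C_def)
  show False
    using core_hexagon[of p r t p' r' s i j l] r r' s t assms distinct
      E_sym[OF t(3)] E_sym[OF s(3)] by (auto simp: A_def C_def)
qed

text \<open>Otherwise p and q have a common neighbour in C; it is also adjacent to p' and closes a
  triangle with p' and q.\<close>

lemma adj_AB_mono:
  assumes "p \<in> A" "p' \<in> A" "q \<in> B" "nbC p \<subseteq> nbC p'" "E p' q"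
  shows "E p q"
proof (rule ccontr)
  assume "\<not> E p q"
  then obtain r where r: "\<tau> r = Core l" "E r p" "E r q"
    using core_common_nbr[of p i q j l] assms distinct by (auto simp: A_def B_def)
  then have "r \<in> nbC p" using E_in(1)[OF r(2)] E_sym[OF r(2)] by (simp add: nbC_def C_def)
  then have "E p' r" using assms(4) by (auto simp: nbC_def)
  then show False using no_triangle[OF _ r(3)] assms(5) by blast
qed

text \<open>A member of the chain containing r has all members avoiding r strictly below it. If it
  avoids r, so do all members below it, and it is itself one more.\<close>

lemma adj_AC: assumes "p \<in> A" "r \<in> C" shows "E p r \<longleftrightarrow> \<gamma> r \<le> \<alpha> p"
proof
  assume e: "E p r"
  have "{S \<in> nbC ` A. r \<notin> S} \<subseteq> {S \<in> nbC ` A. S \<subset> nbC p}"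
  proof
    fix S assume "S \<in> {S \<in> nbC ` A. r \<notin> S}"
    then obtain p' where "p' \<in> A" "S = nbC p'" "r \<notin> S" by auto
    moreover have "r \<in> nbC p" using e assms by (simp add: nbC_def)
    ultimately show "S \<in> {S \<in> nbC ` A. S \<subset> nbC p}" using nbC_chain[OF assms(1)] by blast
  qed
  then show "\<gamma> r \<le> \<alpha> p" unfolding \<gamma>_def \<alpha>_def using fin by (intro card_mono) auto
next
  assume le: "\<gamma> r \<le> \<alpha> p"
  show "E p r"
  proof (rule ccontr)
    assume "\<not> E p r"
    then have "{S \<in> nbC ` A. S \<subset> nbC p} \<subset> {S \<in> nbC ` A. r \<notin> S}"
      using assms by (auto simp: nbC_def)
    then have "\<alpha> p < \<gamma> r" unfolding \<gamma>_def \<alpha>_def using fin by (intro psubset_card_mono) auto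
    then show False using le by simp
  qed
qed

text \<open>By \<open>adj_AB_mono\<close>, the sets \<open>nbC p\<close> of the neighbours p of q
  form an initial segment of the chain, of size \<open>\<beta> q\<close>.\<close>

lemma adj_AB: assumes "p \<in> A" "q \<in> B" shows "E p q \<longleftrightarrow> \<alpha> p < \<beta> q"
proof
  assume e: "E p q"
  have "{S \<in> nbC ` A. S \<subset> nbC p} \<subset> nbC ` {p \<in> A. E p q}"
  proof
    show "{S \<in> nbC ` A. S \<subset> nbC p} \<subseteq> nbC ` {p \<in> A. E p q}"
      using adj_AB_mono[OF _ assms(1,2) _ e] by blast
    show "{S \<in> nbC ` A. S \<subset> nbC p} \<noteq> nbC ` {p \<in> A. E p q}" using e assms by blast
  qed
  then show "\<alpha> p < \<beta> q" unfolding \<beta>_def \<alpha>_def using fin by (intro psubset_card_mono) auto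
next
  assume lt: "\<alpha> p < \<beta> q"
  show "E p q"
  proof (rule ccontr)
    assume n: "\<not> E p q"
    have "nbC ` {p \<in> A. E p q} \<subseteq> {S \<in> nbC ` A. S \<subset> nbC p}"
      using adj_AB_mono[OF assms(1) _ assms(2)] nbC_chain[OF assms(1)] n by blast
    then have "\<beta> q \<le> \<alpha> p" unfolding \<beta>_def \<alpha>_def using fin by (intro card_mono) auto
    then show False using lt by simp
  qed
qed

text \<open>If q and r are adjacent, no neighbour of q in A sees r. Otherwise a common neighbour p
  in A gives \<open>\<gamma> r \<le> \<alpha> p < \<beta> q\<close>.\<close>

lemma adj_BC: assumes "q \<in> B" "r \<in> C" shows "E q r \<longleftrightarrow> \<beta> q \<le> \<gamma> r"
proof
  assume e: "E q r"
  have "nbC ` {p \<in> A. E p q} \<subseteq> {S \<in> nbC ` A. r \<notin> S}"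
    using no_triangle[OF _ e] by (auto simp: nbC_def)
  then show "\<beta> q \<le> \<gamma> r" unfolding \<beta>_def \<gamma>_def using fin by (intro card_mono) auto
next
  assume le: "\<beta> q \<le> \<gamma> r"
  show "E q r"
  proof (rule ccontr)
    assume "\<not> E q r"
    then obtain p where p: "\<tau> p = Core i" "E p q" "E p r"
      using core_common_nbr[of q j r l i] assms distinct by (auto simp: B_def C_def)
    then have "p \<in> A" using E_in by (simp add: A_def)
    then show False using p adj_AB[of p q] adj_AC[of p r] assms le by simp
  qed
qed

lemma \<alpha>_less: "p \<in> A \<Longrightarrow> \<alpha> p < k"
  unfolding \<alpha>_def k_def using fin by (intro psubset_card_mono) auto

lemma \<alpha>_mono: "nbC p \<subset> nbC p' \<Longrightarrow> p \<in> A \<Longrightarrow> \<alpha> p < \<alpha> p'"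
  unfolding \<alpha>_def using fin by (intro psubset_card_mono) auto

lemma \<alpha>_image: "\<alpha> ` A = {..<k}"
proof -
  define rank where "rank = (\<lambda>T. card {S \<in> nbC ` A. S \<subset> T})"
  have rank: "\<alpha> = rank \<circ> nbC" by (simp add: fun_eq_iff \<alpha>_def rank_def)
  have "inj_on rank (nbC ` A)"
  proof (rule inj_onI)
    fix S T assume "S \<in> nbC ` A" "T \<in> nbC ` A" "rank S = rank T"
    then obtain p p' where "p \<in> A" "p' \<in> A" "S = nbC p" "T = nbC p'" "\<alpha> p = \<alpha> p'"
      by (auto simp: rank)
    then show "S = T" using nbC_chain[of p p'] \<alpha>_mono[of p p'] \<alpha>_mono[of p' p] by auto
  qed
  moreover have "\<alpha> ` A = rank ` nbC ` A" by (simp add: rank image_image)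
  ultimately have "card (\<alpha> ` A) = k" by (simp only: card_image k_def)
  moreover have "\<alpha> ` A \<subseteq> {..<k}" using \<alpha>_less by auto
  ultimately show ?thesis by (intro card_subset_eq) auto
qed

lemma \<beta>_bounds: assumes "q \<in> B" shows "0 < \<beta> q" "\<beta> q \<le> k"
proof -
  obtain p where p: "\<tau> p = Core i" "E q p" using not_blind(1) assms by (auto simp: blind_def B_def)
  then have "p \<in> A" using E_in by (simp add: A_def)
  then show "0 < \<beta> q" using adj_AB[of p q] assms E_sym[OF p(2)] by simp
  show "\<beta> q \<le> k" unfolding \<beta>_def k_def using fin by (intro card_mono) auto
qed

lemma \<gamma>_bounds: assumes "r \<in> C" shows "0 < \<gamma> r" "\<gamma> r < k"
proof -
  obtain q where q: "\<tau> q = Core j" "E r q" using not_blind(3) assms by (auto simp: blind_def C_def)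
  then have "q \<in> B" using E_in by (simp add: B_def)
  then show "0 < \<gamma> r" using adj_BC[of q r] \<beta>_bounds[of q] assms E_sym[OF q(2)] by simp
  obtain p where p: "\<tau> p = Core i" "E r p" using not_blind(2) assms by (auto simp: blind_def C_def)
  then have "p \<in> A" using E_in by (simp add: A_def)
  then show "\<gamma> r < k" using adj_AC[of p r] \<alpha>_less[of p] assms E_sym[OF p(2)] by simp
qed

text \<open>A vertex of C separating the consecutive chain members of ranks m - 1 and m has \<gamma>
  equal to m.\<close>

lemma \<gamma>_image: "\<gamma> ` C = {0<..<k}"
proof
  show "\<gamma> ` C \<subseteq> {0<..<k}" using \<gamma>_bounds by auto
  show "{0<..<k} \<subseteq> \<gamma> ` C"
  proof
    fix m assume m: "m \<in> {0<..<k}"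
    then have "m - 1 \<in> \<alpha> ` A" "m \<in> \<alpha> ` A" unfolding \<alpha>_image by auto
    then obtain p p' where p: "p \<in> A" "\<alpha> p = m - 1" "p' \<in> A" "\<alpha> p' = m"
      by (metis imageE)
    then have "\<alpha> p < \<alpha> p'" using m by simp
    then have "nbC p' \<noteq> nbC p" "\<not> nbC p' \<subset> nbC p"
      using \<alpha>_mono[of p' p] p(3) unfolding \<alpha>_def by (force, linarith)
    then obtain r where "r \<in> C" "E p' r" "\<not> E p r" by (auto simp: nbC_def)
    then have "\<gamma> r = m" using adj_AC[of p r] adj_AC[of p' r] p by simp
    then show "m \<in> \<gamma> ` C" using \<open>r \<in> C\<close> by blast
  qed
qed

text \<open>A vertex p of rank \<open>\<gamma> r - 1\<close> just misses r; a common neighbour q in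
  B then satisfies \<open>\<gamma> r - 1 < \<beta> q \<le> \<gamma> r\<close>.\<close>

lemma \<gamma>_subset_\<beta>: "\<gamma> ` C \<subseteq> \<beta> ` B"
proof
  fix m assume "m \<in> \<gamma> ` C"
  then obtain r where r: "r \<in> C" "\<gamma> r = m" by blast
  then have "m - 1 \<in> \<alpha> ` A" unfolding \<alpha>_image using \<gamma>_bounds[of r] by auto
  then obtain p where p: "p \<in> A" "\<alpha> p = m - 1" by (metis imageE)
  have "\<not> E p r" using adj_AC[of p r] p r \<gamma>_bounds[of r] by simp
  then obtain q where q: "\<tau> q = Core j" "E q p" "E q r"
    using core_common_nbr[of p i r l j] p r distinct by (auto simp: A_def C_def)
  then have "q \<in> B" using E_in by (simp add: B_def)
  then have "\<beta> q = m" using adj_AB[of p q] adj_BC[of q r] p q r E_sym[OF q(2)] by simp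
  then show "m \<in> \<beta> ` B" using \<open>q \<in> B\<close> by blast
qed

lemma \<beta>_image: "\<beta> ` B = {0<..<k} \<union> (if k \<in> \<beta> ` B then {k} else {})"
proof -
  have "\<beta> ` B \<subseteq> {0<..k}" using \<beta>_bounds by auto
  moreover have "{0<..<k} \<subseteq> \<beta> ` B" using \<gamma>_subset_\<beta> \<gamma>_image by simp
  moreover have "M = {0<..<k} \<union> (if k \<in> M then {k} else {})"
    if "M \<subseteq> {0<..k}" "{0<..<k} \<subseteq> M" for M
    using that by (force simp: le_less)
  ultimately show ?thesis by blast
qed

lemma k_ge_2: "2 \<le> k"
proof -
  obtain r where "r \<in> C" using inhabited[of "Core l"] by (auto simp: C_def)
  then show ?thesis using \<gamma>_bounds[of r] by simp
qed

section \<open>The map onto the Vega graph\<close>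

text \<open>The ranks \<beta> and \<gamma> start at 1, hence the shifts by one; \<beta> = k gives
  the label 2k-1, which may be missing.\<close>

definition \<phi> :: "'a \<Rightarrow> vega_vertex" where
  "\<phi> x = (case \<tau> x of
     Core r \<Rightarrow> Num (if r = i then \<alpha> x else if r = j then k + \<beta> x - 1 else 2 * k + \<gamma> x - 1)
   | Outer r \<Rightarrow> (if r = i then VA else if r = j then VB else VC)
   | Inner r \<Rightarrow> (if r = i then VU else if r = j then VV else VW)
   | Apex \<Rightarrow> VX | Coapex \<Rightarrow> VY)"

text \<open>Modulo 3n-1, negation maps the interval from n to 2n-1 onto itself. Of the two truncated
  differences at most one is nonzero.\<close>

lemma andrasfai_adj_iff:
  assumes "2 \<le> n"
  shows "andrasfai_adj n a b \<longleftrightarrow> a < 3 * n - 1 \<and> b < 3 * n - 1 \<and>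
    (n \<le> a - b \<and> a - b \<le> 2 * n - 1 \<or> n \<le> b - a \<and> b - a \<le> 2 * n - 1)"
proof -
  define N where "N = int (3 * n - 1)"
  have N: "N = 3 * int n - 1" using assms by (simp add: N_def)
  consider "a < 3 * n - 1" "b < 3 * n - 1" "b \<le> a" | "a < 3 * n - 1" "b < 3 * n - 1" "a < b"
    | "\<not> (a < 3 * n - 1 \<and> b < 3 * n - 1)" by linarith
  then show ?thesis
  proof cases
    case 1
    then have "(int a - int b) mod N = int a - int b" using N by (intro mod_pos_pos_trivial) auto
    then show ?thesis using 1 assms unfolding andrasfai_adj_def N_def[symmetric] Let_def by auto
  next
    case 2
    then have "(int a - int b) mod N = (int a - int b + N) mod N" by simp
    also have "\<dots> = int a - int b + N" using N 2 assms by (intro mod_pos_pos_trivial) auto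
    finally show ?thesis using 2 assms N unfolding andrasfai_adj_def N_def[symmetric] Let_def by auto
  next
    case 3
    then show ?thesis by (auto simp: andrasfai_adj_def)
  qed
qed


lemma class_cases:
  obtains "s = Core i" | "s = Core j" | "s = Core l" | "s = Outer i" | "s = Outer j" | "s = Outer l"
    | "s = Inner i" | "s = Inner j" | "s = Inner l" | "s = Apex" | "s = Coapex"
  using other_role[OF distinct] by (cases s) metis+

lemma \<phi>_simps:
  "\<tau> x = Core i \<Longrightarrow> \<phi> x = Num (\<alpha> x)"
  "\<tau> x = Core j \<Longrightarrow> \<phi> x = Num (k + \<beta> x - 1)"
  "\<tau> x = Core l \<Longrightarrow> \<phi> x = Num (2 * k + \<gamma> x - 1)"
  "\<tau> x = Outer i \<Longrightarrow> \<phi> x = VA" "\<tau> x = Outer j \<Longrightarrow> \<phi> x = VB" "\<tau> x = Outer l \<Longrightarrow> \<phi> x = VC"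
  "\<tau> x = Inner i \<Longrightarrow> \<phi> x = VU" "\<tau> x = Inner j \<Longrightarrow> \<phi> x = VV" "\<tau> x = Inner l \<Longrightarrow> \<phi> x = VW"
  "\<tau> x = Apex \<Longrightarrow> \<phi> x = VX" "\<tau> x = Coapex \<Longrightarrow> \<phi> x = VY"
  using distinct by (simp_all add: \<phi>_def)

lemma core_bounds:
  assumes "x \<in> V"
  shows "\<tau> x = Core i \<Longrightarrow> \<alpha> x < k"
    "\<tau> x = Core j \<Longrightarrow> 0 < \<beta> x" "\<tau> x = Core j \<Longrightarrow> \<beta> x \<le> k"
    "\<tau> x = Core l \<Longrightarrow> 0 < \<gamma> x" "\<tau> x = Core l \<Longrightarrow> \<gamma> x < k"
  using assms \<alpha>_less \<beta>_bounds \<gamma>_bounds by (auto simp: A_def B_def C_def)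

lemma vega_adj_commute: "vega_adj n x y \<longleftrightarrow> vega_adj n y x"
  by (auto simp: vega_adj_def)

text \<open>Labels within one core differ by less than k. Between different cores the difference
  lies in the interval from k to 2k-1 exactly if \<alpha> < \<beta>, \<gamma> \<le> \<alpha> or
  \<beta> \<le> \<gamma>, respectively.\<close>

lemma adj_iff_core:
  assumes "x \<in> V" "y \<in> V"
  shows "\<tau> x = Core i \<Longrightarrow> \<tau> y = Core i \<Longrightarrow> E x y \<longleftrightarrow> vega_adj k (\<phi> x) (\<phi> y)"
    "\<tau> x = Core j \<Longrightarrow> \<tau> y = Core j \<Longrightarrow> E x y \<longleftrightarrow> vega_adj k (\<phi> x) (\<phi> y)"
    "\<tau> x = Core l \<Longrightarrow> \<tau> y = Core l \<Longrightarrow> E x y \<longleftrightarrow> vega_adj k (\<phi> x) (\<phi> y)"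
    "\<tau> x = Core i \<Longrightarrow> \<tau> y = Core j \<Longrightarrow> E x y \<longleftrightarrow> vega_adj k (\<phi> x) (\<phi> y)"
    "\<tau> x = Core i \<Longrightarrow> \<tau> y = Core l \<Longrightarrow> E x y \<longleftrightarrow> vega_adj k (\<phi> x) (\<phi> y)"
    "\<tau> x = Core j \<Longrightarrow> \<tau> y = Core l \<Longrightarrow> E x y \<longleftrightarrow> vega_adj k (\<phi> x) (\<phi> y)"
proof -
  have same: "\<not> E x y" if "\<tau> x = \<tau> y" "\<tau> x = Core r" for r
    using adj_class[of x y] that by (metis class_adj.simps(1))
  note simps = \<phi>_simps vega_adj_def andrasfai_adj_iff[OF k_ge_2]
  show "\<tau> x = Core i \<Longrightarrow> \<tau> y = Core i \<Longrightarrow> E x y \<longleftrightarrow> vega_adj k (\<phi> x) (\<phi> y)"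
    using same core_bounds[OF assms(1)] core_bounds[OF assms(2)] by (auto simp: simps)
  show "\<tau> x = Core j \<Longrightarrow> \<tau> y = Core j \<Longrightarrow> E x y \<longleftrightarrow> vega_adj k (\<phi> x) (\<phi> y)"
    using same core_bounds[OF assms(1)] core_bounds[OF assms(2)] by (auto simp: simps)
  show "\<tau> x = Core l \<Longrightarrow> \<tau> y = Core l \<Longrightarrow> E x y \<longleftrightarrow> vega_adj k (\<phi> x) (\<phi> y)"
    using same core_bounds[OF assms(1)] core_bounds[OF assms(2)] by (auto simp: simps)
  show "\<tau> x = Core i \<Longrightarrow> \<tau> y = Core j \<Longrightarrow> E x y \<longleftrightarrow> vega_adj k (\<phi> x) (\<phi> y)"
    using adj_AB[of x y] assms core_bounds[OF assms(1)] core_bounds[OF assms(2)]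
    by (auto simp: simps A_def B_def)
  show "\<tau> x = Core i \<Longrightarrow> \<tau> y = Core l \<Longrightarrow> E x y \<longleftrightarrow> vega_adj k (\<phi> x) (\<phi> y)"
    using adj_AC[of x y] assms core_bounds[OF assms(1)] core_bounds[OF assms(2)]
    by (auto simp: simps A_def C_def)
  show "\<tau> x = Core j \<Longrightarrow> \<tau> y = Core l \<Longrightarrow> E x y \<longleftrightarrow> vega_adj k (\<phi> x) (\<phi> y)"
    using adj_BC[of x y] assms core_bounds[OF assms(1)] core_bounds[OF assms(2)]
    by (auto simp: simps B_def C_def)
qed

lemma adj_iff_noncore:
  assumes "x \<in> V" "y \<in> V" "\<And>r. \<tau> y \<noteq> Core r"
  shows "E x y \<longleftrightarrow> vega_adj k (\<phi> x) (\<phi> y)"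
proof -
  have "E x y \<longleftrightarrow> class_adj (\<tau> x) (\<tau> y)"
    using adj_class adj_complete assms by blast
  also have "\<dots> \<longleftrightarrow> vega_adj k (\<phi> x) (\<phi> y)"
    by (rule class_cases[of "\<tau> x"]; rule class_cases[of "\<tau> y"];
        use assms(3) core_bounds[OF assms(1)] distinct in \<open>simp add: \<phi>_simps vega_adj_def\<close>; linarith?)
  finally show ?thesis .
qed

lemma adj_iff: "x \<in> V \<Longrightarrow> y \<in> V \<Longrightarrow> E x y \<longleftrightarrow> vega_adj k (\<phi> x) (\<phi> y)"
proof (cases "\<exists>r s. \<tau> x = Core r \<and> \<tau> y = Core s")
  case True
  assume V: "x \<in> V" "y \<in> V"
  obtain r s where "\<tau> x = Core r" "\<tau> y = Core s" using True by blast
  then show ?thesis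
    using adj_iff_core[OF V] adj_iff_core[OF V(2,1)] other_role[OF distinct, of r]
      other_role[OF distinct, of s] E_commute[of x y] vega_adj_commute[of k "\<phi> x" "\<phi> y"] by metis
next
  case False
  assume V: "x \<in> V" "y \<in> V"
  then show ?thesis
    using adj_iff_noncore[OF V] adj_iff_noncore[OF V(2,1)] False
      E_commute[of x y] vega_adj_commute[of k "\<phi> x" "\<phi> y"] by blast
qed

lemma \<phi>_image_core: "\<phi> ` (A \<union> B \<union> C) = Num ` ({..<3 * k - 1} - (if k \<in> \<beta> ` B then {} else {2 * k - 1}))"
proof -
  have A: "\<phi> ` A = Num ` {..<k}"
    unfolding \<alpha>_image[symmetric] by (auto simp: A_def \<phi>_simps image_iff)
  have "\<phi> ` B = (\<lambda>m. Num (k + m - 1)) ` \<beta> ` B"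
    by (auto simp: B_def \<phi>_simps image_iff)
  also have "\<dots> = Num ` (\<lambda>m. k + m - 1) ` ({0<..<k} \<union> (if k \<in> \<beta> ` B then {k} else {}))"
    by (subst \<beta>_image) (simp add: image_image)
  also have "(\<lambda>m. k + m - 1) ` ({0<..<k} \<union> (if k \<in> \<beta> ` B then {k} else {})) =
      {k..<2 * k - 1} \<union> (if k \<in> \<beta> ` B then {2 * k - 1} else {})"
  proof -
    have "(\<lambda>m. k + m - 1) ` {0<..<k} = {k..<2 * k - 1}"
    proof (intro equalityI subsetI)
      fix n assume "n \<in> {k..<2 * k - 1}"
      then show "n \<in> (\<lambda>m. k + m - 1) ` {0<..<k}" by (intro image_eqI[of _ _ "n + 1 - k"]) auto
    qed auto
    then show ?thesis using k_ge_2 by auto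
  qed
  finally have B: "\<phi> ` B = Num ` ({k..<2 * k - 1} \<union> (if k \<in> \<beta> ` B then {2 * k - 1} else {}))" .
  have "\<phi> ` C = Num ` (\<lambda>m. 2 * k + m - 1) ` \<gamma> ` C"
    by (auto simp: C_def \<phi>_simps image_iff)
  also have "(\<lambda>m. 2 * k + m - 1) ` \<gamma> ` C = {2 * k..<3 * k - 1}"
    unfolding \<gamma>_image
  proof (intro equalityI subsetI)
    fix n assume "n \<in> {2 * k..<3 * k - 1}"
    then show "n \<in> (\<lambda>m. 2 * k + m - 1) ` {0<..<k}" by (intro image_eqI[of _ _ "n + 1 - 2 * k"]) auto
  qed auto
  finally have C: "\<phi> ` C = Num ` {2 * k..<3 * k - 1}" .
  have "{..<k} \<union> ({k..<2 * k - 1} \<union> (if k \<in> \<beta> ` B then {2 * k - 1} else {})) \<union> {2 * k..<3 * k - 1} =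
    {..<3 * k - 1} - (if k \<in> \<beta> ` B then {} else {2 * k - 1})"
    using k_ge_2 by auto
  then show ?thesis unfolding image_Un A B C by (metis image_Un)
qed

text \<open>The flags \<mu> and \<nu> record whether the class of y is empty and whether \<beta>
  omits the value k.\<close>

lemma \<phi>_image: "\<phi> ` V = vega_verts k (\<forall>p\<in>V. \<tau> p \<noteq> Coapex) (k \<notin> \<beta> ` B)"
proof -
  define N where "N = {p \<in> V. \<forall>r. \<tau> p \<noteq> Core r}"
  have V: "V = (A \<union> B \<union> C) \<union> N"
  proof (intro equalityI subsetI)
    fix x assume "x \<in> V"
    then show "x \<in> (A \<union> B \<union> C) \<union> N"
      by (cases rule: class_cases[of "\<tau> x"]) (auto simp: A_def B_def C_def N_def)
  qed (auto simp: A_def B_def C_def N_def)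
  have sub: "\<phi> ` N \<subseteq> {VA, VB, VC, VU, VV, VW, VX} \<union> (if \<forall>p\<in>V. \<tau> p \<noteq> Coapex then {} else {VY})"
  proof
    fix v assume "v \<in> \<phi> ` N"
    then obtain p where p: "p \<in> V" "\<And>r. \<tau> p \<noteq> Core r" "v = \<phi> p" by (auto simp: N_def)
    then show "v \<in> {VA, VB, VC, VU, VV, VW, VX} \<union> (if \<forall>p\<in>V. \<tau> p \<noteq> Coapex then {} else {VY})"
      by (cases rule: class_cases[of "\<tau> p"]) (auto simp: \<phi>_simps)
  qed
  have img: "v \<in> \<phi> ` N"
    if ex: "\<exists>p\<in>V. \<tau> p = s" and s: "\<And>r. s \<noteq> Core r" "\<And>x. \<tau> x = s \<Longrightarrow> \<phi> x = v" for s v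
  proof -
    obtain p where "p \<in> V" "\<tau> p = s" using ex by blast
    then show ?thesis using s by (auto simp: N_def intro!: image_eqI[of _ _ p])
  qed
  have "VA \<in> \<phi> ` N" "VB \<in> \<phi> ` N" "VC \<in> \<phi> ` N" "VU \<in> \<phi> ` N" "VV \<in> \<phi> ` N" "VW \<in> \<phi> ` N" "VX \<in> \<phi> ` N"
    by (rule img[OF inhabited _ \<phi>_simps(4)] img[OF inhabited _ \<phi>_simps(5)]
        img[OF inhabited _ \<phi>_simps(6)] img[OF inhabited _ \<phi>_simps(7)]
        img[OF inhabited _ \<phi>_simps(8)] img[OF inhabited _ \<phi>_simps(9)]
        img[OF inhabited _ \<phi>_simps(10)]; simp)+
  moreover have "VY \<in> \<phi> ` N" if "\<not> (\<forall>p\<in>V. \<tau> p \<noteq> Coapex)"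
    using that by (intro img[OF _ _ \<phi>_simps(11)]) auto
  ultimately have "{VA, VB, VC, VU, VV, VW, VX} \<union> (if \<forall>p\<in>V. \<tau> p \<noteq> Coapex then {} else {VY}) \<subseteq> \<phi> ` N"
    by simp
  with sub have N: "\<phi> ` N = {VA, VB, VC, VU, VV, VW, VX} \<union> (if \<forall>p\<in>V. \<tau> p \<noteq> Coapex then {} else {VY})"
    by (rule equalityI)
  show ?thesis
    by (subst V) (simp only: image_Un[of _ "A \<union> B \<union> C"] \<phi>_image_core N, auto simp: vega_verts_def)
qed

lemma blow_up: "blow_up V E (vega_verts k (\<forall>p\<in>V. \<tau> p \<noteq> Coapex) (k \<notin> \<beta> ` B)) (vega_adj k)"
  unfolding blow_up_def using \<phi>_image adj_iff by blast

end

lemma (in vega_partition) vega_blow_up: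
  "\<exists>i \<mu> \<nu>. i \<ge> 2 \<and> blow_up V E (vega_verts i \<mu> \<nu>) (vega_adj i)"
proof -
  obtain i j l where "i \<noteq> j" "j \<noteq> l" "i \<noteq> l" "\<not> blind j i" "\<not> blind l i" "\<not> blind l j"
    by (rule exists_roles)
  then interpret vega_roles V E \<tau> i j l
    by unfold_locales
  show ?thesis using blow_up k_ge_2 by blast
qed

section \<open>The classes determined by the traces\<close>

text \<open>Parallel to \<open>vega_traces\<close>, whose first eleven entries are the traces of c,
  b_0, ..., b_4, a_0, ..., a_4.\<close>

definition vega_classes :: "vclass list" where
  "vega_classes =
   [Outer R1, Inner R1, Core R3, Outer R2, Outer R3, Core R2, Apex, Inner R2, Core R1, Core R1, Inner R3,
    Core R1, Coapex, Core R2, Core R3, Core R2, Core R3, Core R2, Core R3]"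

definition class_of :: "bool list \<Rightarrow> vclass" where
  "class_of t = the (map_of (zip vega_traces vega_classes) t)"

lemma class_of_adj:
  "list_all (\<lambda>s. list_all (\<lambda>t. disjoint_rows s t \<longrightarrow> class_adj (class_of s) (class_of t)) vega_traces) vega_traces"
  by code_simp

lemma class_of_inhabited:
  "list_all (\<lambda>s. list_ex (\<lambda>i. class_of (map (adj_at mg_rows i) [0..<11]) = s) [0..<11])
   [Core R1, Core R2, Core R3, Outer R1, Outer R2, Outer R3, Inner R1, Inner R2, Inner R3, Apex]"
  by code_simp

text \<open>Adjacent vertices have disjoint traces, so compatibility is the finite check
  \<open>class_of_adj\<close>; the vertices of the copy themselves inhabit every class but
  \<open>Coapex\<close>.\<close>

lemma (in mtf_graph) vega_partition:
  assumes "finite V" "mg_copy g" "\<And>y. y \<in> V \<Longrightarrow> trace g 11 y \<in> set vega_traces"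
  shows "vega_partition V E (\<lambda>y. class_of (trace g 11 y))"
proof
  show "finite V" by fact
next
  fix p q assume e: "E p q"
  have "disjoint_rows (trace g 11 p) (trace g 11 q)"
    using no_triangle[of p q] e by (auto simp: disjoint_rows_iff)
  then show "class_adj (class_of (trace g 11 p)) (class_of (trace g 11 q))"
    using class_of_adj assms(3) E_in[OF e] by (simp add: list_all_iff)
next
  fix s :: vclass assume s: "s \<noteq> Coapex"
  have role: "r \<in> {R1, R2, R3}" for r
    by (cases r) auto
  have "s \<in> set [Core R1, Core R2, Core R3, Outer R1, Outer R2, Outer R3,
      Inner R1, Inner R2, Inner R3, Apex]"
    using s role by (cases s) auto
  then have "list_ex (\<lambda>i. class_of (map (adj_at mg_rows i) [0..<11]) = s) [0..<11]"
    using class_of_inhabited unfolding list_all_iff by (rule bspec[rotated])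
  then obtain i where "i \<in> {0..<11}" and cls: "class_of (map (adj_at mg_rows i) [0..<11]) = s"
    unfolding list_ex_iff set_upt by blast
  then have i: "i < 11" by simp
  have "map (adj_at mg_rows i) [0..<11] = trace g 11 (g i)"
    unfolding trace_def
    using adj_at_realizes[OF mg_copy_realizes[OF assms(2)]] i by (intro map_cong refl) simp
  then have "class_of (trace g 11 (g i)) = s" using cls by (simp only:)
  moreover have "g i \<in> V" using i assms(2) by (simp add: mg_copy_def)
  ultimately show "\<exists>p\<in>V. class_of (trace g 11 p) = s" by blast
qed

theorem theorem1p3:
  fixes V :: "'a set" and E :: "'a \<Rightarrow> 'a \<Rightarrow> bool"
  assumes "graph V E"
    and "finite V"
    and "maximal_triangle_free V E"
    and "contains_subgraph mg_verts mg_adj V E"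
    and "prop_D 4 V E"
  shows "\<exists>i \<mu> \<nu>. i \<ge> 2 \<and> blow_up V E (vega_verts i \<mu> \<nu>) (\<lambda>x y. vega_adj i x y)"
proof -
  interpret mtf_graph V E
    by (rule mtf_graph.intro) fact+
  obtain f where f: "f ` mg_verts \<subseteq> V" "\<forall>x\<in>mg_verts. \<forall>y\<in>mg_verts. mg_adj x y \<longrightarrow> E (f x) (f y)"
    using assms(4) unfolding contains_subgraph_def by (elim exE conjE)
  \<comment> \<open>The numbering of \<Upsilon> used by \<open>mg_rows\<close>.\<close>
  define v where "v i = (if i < 5 then MA i else if i < 10 then MB (i - 5) else MC)" for i
  have verts: "v i \<in> mg_verts" if "i < 11" for i
    using that by (auto simp: v_def mg_verts_def)
  have edges: "mg_adj (v i) (v j)" if "i < 11" "j < i" "mg_rows ! i ! j" for i j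
  proof -
    have "list_all (\<lambda>i. list_all (\<lambda>j. mg_rows ! i ! j \<longrightarrow> mg_adj (v i) (v j)) [0..<i]) [0..<11]"
      unfolding v_def mg_adj_def by code_simp
    then show ?thesis using that by (simp add: list_all_iff)
  qed
  have "mg_copy (\<lambda>i. f (v i))"
    unfolding mg_copy_def
  proof (intro conjI allI impI)
    fix i :: nat assume i: "i < 11"
    then show "f (v i) \<in> V" using f(1) verts by blast
    fix j assume "j < i" "mg_rows ! i ! j"
    then show "E (f (v i)) (f (v j))" using f(2) verts edges i by (meson less_trans)
  qed
  then obtain g where "mg_copy g" "\<And>y. y \<in> V \<Longrightarrow> trace g 11 y \<in> set vega_traces"
    using exists_vega_copy by blast
  then interpret vega_partition V E "\<lambda>y. class_of (trace g 11 y)"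
    using vega_partition assms(2) by blast
  show ?thesis using vega_blow_up by simp
qed

end
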